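(* Let $\mathcal{C}\subseteq\mathbb{R}^n$ be a polyhedral set and let $f:\mathbb{R}^n\to\mathbb{R}$ be convex, twice continuously differentiable and bounded below, and suppose there exist constants $0<\mu_1\le\mu_2<\infty$ such that $\mu_1\|v\|_2^2\le v^T\nabla^2 f(x)\,v\le\mu_2\|v\|_2^2$ for all $x,v\in\mathbb{R}^n$. Let $x_0\in\mathcal{C}$. Then the sequence $\{x_t\}$ generated by the hybrid quasi-Newton projected-gradient algorithm (described in the context) started at $x_0$ converges to the unique minimizer of the problem: minimize $f(x)$ subject to $x\in\mathcal{C}$.
   Context: Notation. $\mathcal{P}(v)=\mathrm{argmin}_{x\in\mathcal{C}}\|x-v\|_2$ is orthogonal projection onto $\mathcal{C}$. For $x\in\mathcal{C}$, $\mathcal{F}(x)$ is the unique face $\mathcal{F}$ of $\mathcal{C}$ (possibly $\mathcal{C}$ itself) with $x\in\mathrm{relint}(\mathcal{F})$. The normal cone is $\mathcal{N}(x)=\{d\in\mathbb{R}^n\mid \mathcal{P}(x+d)=x\}$; for a face $\mathcal{F}$, $\mathcal{N}(\mathcal{F})$ is $\mathcal{N}(x)$ for any $x\in\mathrm{relint}(\mathcal{F})$. The difference hull $\mathrm{diff\ hull}(\mathcal{F})$ is the linear span of $\{u_1-u_2\mid u_1,u_2\in\mathcal{F}\}$. The self-projection cone of a face is $\mathrm{self\ proj}(\mathcal{F})=\mathcal{N}(\mathcal{F})+\mathrm{diff\ hull}(\mathcal{F})$ (equivalently, for any $x\in\mathrm{relint}(\mathcal{F})$, the set of $d$ for which there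 is $\epsilon>0$ with $\mathcal{F}(\mathcal{P}(x+\epsilon d))=\mathcal{F}$). For a face $\mathcal{F}$ of dimension $k\ge1$, $\Phi(\mathcal{F})\in\mathbb{R}^{n\times k}$ is a fixed matrix whose columns form an orthonormal basis of $\mathrm{diff\ hull}(\mathcal{F})$. Fixed parameters: $0<\alpha_{\min}<\alpha_{\max}$; $\eta,\gamma\in(0,1)$; an integer $M\ge1$ (length of the objective history); $0<\gamma_1<\tfrac12$, $\gamma_1<\gamma_2<1$; an integer $N\ge1$ (L-BFGS memory); $\mu>0$ (initial scaling); $\alpha_0\in[\alpha_{\min},\alpha_{\max}]$. Hybrid algorithm. Write $g_t=\nabla f(x_t)$ and $\mathcal{F}_t=\mathcal{F}(x_t)$. Start with $t=0$ and no quadratic model ($H_0=\emptyset$). At iteration $t$ (if $x_t$ already satisfies $\mathcal{P}(x_t-g_t)=x_t$, the algorithm may stop and the sequence is regarded as constant from there on): 1. Quasi-Newton step. If $H_t\ne\emptyset$, set $d_t=-\Phi_tH_t\Phi_t^Tg_t$ and perform a line search over $\{\theta>0\mid x_t+\theta d_t\in\mathcal{F}_t\}$, which either returns a step $\theta_t$ in this set satisfying the Wolfe conditions $f(x_t+\theta_td_t)\le f(x_t)+\gamma_1\theta_tg_t^Td_t$ and $\nabla f(x_t+\theta_td_t)^Td_t\ge\gamma_2g_t^Td_t$, or fails. If it is successful, set $x_{t+1}=x_t+\theta_td_t$ and reset the history of objective values, so that later history maxima only involve objective values from iterate $x_{t+1}$ onward. 2. Projected-gradient step. If no quasi-Newton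 step was taken (no model, or failed line search), take a nonmonotone spectral projected-gradient step: for $t>0$, with $s=x_t-x_{t-1}$ and $y=g_t-g_{t-1}$, let $\alpha_t=\max\{\min\{s^Ts/s^Ty,\alpha_{\max}\},\alpha_{\min}\}$ if $s^Ty>0$ and $\alpha_t=\alpha_{\max}$ otherwise; let $x(\alpha)=\mathcal{P}(x_t-\alpha g_t)$; let $k$ be the smallest nonnegative integer with $f(x(\eta^k\alpha_t))\le f_{\mathrm{hist}}+\gamma g_t^T(x(\eta^k\alpha_t)-x_t)$, where $f_{\mathrm{hist}}$ is the maximum of the (at most $M$) most recent objective values $f(x_t),f(x_{t-1}),\dots$ recorded since the last reset; set $x_{t+1}=x(\eta^k\alpha_t)$. 3. Model update. Replace $t$ by $t+1$. If $\mathcal{F}_t=\mathcal{F}_{t-1}$ and $-g_t\in\mathrm{self\ proj}(\mathcal{F}_t)$, then: if $H_{t-1}=\emptyset$, initialize the model with $\mu I$ and set $\Phi_t=\Phi(\mathcal{F}_t)$, otherwise keep $\Phi_t=\Phi_{t-1}$; let $H_t$ be the L-BFGS inverse-Hessian approximation obtained by including the new pair $s_t=\Phi_t^T(x_t-x_{t-1})$, $y_t=\Phi_t^T(g_t-g_{t-1})$. That is, $H_t$ results from starting with $\mu I$ and applying successively, for the at most $N$ most recent pairs $(s,y)$ collected since the model was last initialized (oldest first), the BFGS inverse update $H\mapsto (I-\rho sy^T)H(I-\rho ys^T)+\rho ss^T$, $\rho=1/(y^Ts)$. Otherwise set $H_t=\emptyset$. *)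

theory Defs
  imports "HOL-Analysis.Analysis" "Jordan_Normal_Form.Matrix"
begin

text \<open>The iterates live in \<^typ>\<open>real ^ 'n\<close>. The dimension of a face varies along the
  iteration, so the reduced vectors and the reduced inverse Hessians are vectors and matrices
  with run-time dimensions. Below, \<open>\<bullet>\<close> is the inner product of \<^typ>\<open>real ^ 'n\<close> and \<open>$\<close> indexes
  reduced vectors.\<close>

no_notation scalar_prod (infix \<open>\<bullet>\<close> 70)
no_notation vec_nth (infixl \<open>$\<close> 90)

definition face_at :: "(real ^ 'n) set \<Rightarrow> real ^ 'n \<Rightarrow> (real ^ 'n) set" where
  "face_at C x = (THE F. F face_of C \<and> x \<in> rel_interior F)"

definition normal_cone_at :: "(real ^ 'n) set \<Rightarrow> real ^ 'n \<Rightarrow> (real ^ 'n) set" where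
  "normal_cone_at C x = {d. closest_point C (x + d) = x}"

text \<open>The normal cone is constant on the relative interior of a face.\<close>

definition normal_cone_face :: "(real ^ 'n) set \<Rightarrow> (real ^ 'n) set \<Rightarrow> (real ^ 'n) set" where
  "normal_cone_face C F = normal_cone_at C (SOME x. x \<in> rel_interior F)"

definition diff_hull :: "(real ^ 'n) set \<Rightarrow> (real ^ 'n) set" where
  "diff_hull F = span {u1 - u2 | u1 u2. u1 \<in> F \<and> u2 \<in> F}"

definition self_proj :: "(real ^ 'n) set \<Rightarrow> (real ^ 'n) set \<Rightarrow> (real ^ 'n) set" where
  "self_proj C F = {u + v | u v. u \<in> normal_cone_face C F \<and> v \<in> diff_hull F}"

text \<open>An \<open>n \<times> k\<close> matrix is represented by the list of its \<open>k\<close> columns.\<close>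

definition orthonormal_columns :: "(real ^ 'n) list \<Rightarrow> (real ^ 'n) set \<Rightarrow> bool" where
  "orthonormal_columns B V \<longleftrightarrow>
     (\<forall>i < length B. \<forall>j < length B. B ! i \<bullet> B ! j = (if i = j then 1 else 0)) \<and>
     span (set B) = V"

text \<open>\<open>lift_vec B\<close> is multiplication by the matrix with columns \<open>B\<close>, and \<open>reduce_vec B\<close>
  multiplication by its transpose.\<close>

definition lift_vec :: "(real ^ 'n) list \<Rightarrow> real Matrix.vec \<Rightarrow> real ^ 'n" where
  "lift_vec B w = (\<Sum>i < length B. (w $ i) *\<^sub>R (B ! i))"

definition reduce_vec :: "(real ^ 'n) list \<Rightarrow> real ^ 'n \<Rightarrow> real Matrix.vec" where
  "reduce_vec B v = Matrix.vec (length B) (\<lambda>i. B ! i \<bullet> v)"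

definition outer_mat :: "real Matrix.vec \<Rightarrow> real Matrix.vec \<Rightarrow> real Matrix.mat" where
  "outer_mat u v = Matrix.mat (dim_vec u) (dim_vec v) (\<lambda>(i, j). (u $ i) * (v $ j))"

definition bfgs_update ::
    "real Matrix.mat \<Rightarrow> real Matrix.vec \<times> real Matrix.vec \<Rightarrow> real Matrix.mat" where
  "bfgs_update H = (\<lambda>(s, y).
     let \<rho> = 1 / scalar_prod y s; I = 1\<^sub>m (dim_vec s) in
       (I - \<rho> \<cdot>\<^sub>m outer_mat s y) * H * (I - \<rho> \<cdot>\<^sub>m outer_mat y s) + \<rho> \<cdot>\<^sub>m outer_mat s s)"

text \<open>The pairs are listed oldest first; only the last \<open>N\<close> of them are used.\<close>

definition lbfgs_mat ::
    "nat \<Rightarrow> real \<Rightarrow> nat \<Rightarrow> (real Matrix.vec \<times> real Matrix.vec) list \<Rightarrow> real Matrix.mat" where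
  "lbfgs_mat N \<mu> k ps =
     foldl bfgs_update (\<mu> \<cdot>\<^sub>m 1\<^sub>m k) (drop (length ps - N) ps)"

record hybrid_params =
  alpha_min :: real
  alpha_max :: real
  alpha_0 :: real
  eta :: real
  gamma :: real
  gamma_1 :: real
  gamma_2 :: real
  mu :: real
  hist_len :: nat  \<comment> \<open>length \<open>M\<close> of the objective history\<close>
  memory :: nat    \<comment> \<open>L-BFGS memory \<open>N\<close>\<close>

definition valid_params :: "hybrid_params \<Rightarrow> bool" where
  "valid_params p \<longleftrightarrow>
     0 < alpha_min p \<and> alpha_min p < alpha_max p \<and>
     alpha_min p \<le> alpha_0 p \<and> alpha_0 p \<le> alpha_max p \<and>
     0 < eta p \<and> eta p < 1 \<and> 0 < gamma p \<and> gamma p < 1 \<and>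
     0 < gamma_1 p \<and> gamma_1 p < 1 / 2 \<and> gamma_1 p < gamma_2 p \<and> gamma_2 p < 1 \<and>
     0 < mu p \<and> 1 \<le> hist_len p \<and> 1 \<le> memory p"

definition qn_direction ::
    "(real ^ 'n) list \<Rightarrow> real Matrix.mat \<Rightarrow> real ^ 'n \<Rightarrow> real ^ 'n" where
  "qn_direction B H v = - lift_vec B (H *\<^sub>v reduce_vec B v)"

text \<open>Successful outcomes of the line search along \<open>d\<close>: \<open>x'\<close> is a point it may return.\<close>

definition qn_step ::
    "hybrid_params \<Rightarrow> (real ^ 'n) set \<Rightarrow> (real ^ 'n \<Rightarrow> real) \<Rightarrow> (real ^ 'n \<Rightarrow> real ^ 'n) \<Rightarrow>
     real ^ 'n \<Rightarrow> real ^ 'n \<Rightarrow> real ^ 'n \<Rightarrow> bool" where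
  "qn_step p C f g x d x' \<longleftrightarrow>
     (\<exists>\<theta> > 0. x + \<theta> *\<^sub>R d \<in> face_at C x \<and>
        f (x + \<theta> *\<^sub>R d) \<le> f x + gamma_1 p * \<theta> * (g x \<bullet> d) \<and>
        g (x + \<theta> *\<^sub>R d) \<bullet> d \<ge> gamma_2 p * (g x \<bullet> d) \<and>
        x' = x + \<theta> *\<^sub>R d)"

definition spectral_step ::
    "hybrid_params \<Rightarrow> (real ^ 'n \<Rightarrow> real ^ 'n) \<Rightarrow> (nat \<Rightarrow> real ^ 'n) \<Rightarrow> nat \<Rightarrow> real" where
  "spectral_step p g x t =
     (if t = 0 then alpha_0 p
      else let s = x t - x (t - 1); y = g (x t) - g (x (t - 1)) in
        if s \<bullet> y > 0 then max (min ((s \<bullet> s) / (s \<bullet> y)) (alpha_max p)) (alpha_min p)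
        else alpha_max p)"

text \<open>\<open>r\<close> is the index of the first iterate recorded since the last reset.\<close>

definition hist_max ::
    "hybrid_params \<Rightarrow> (real ^ 'n \<Rightarrow> real) \<Rightarrow> (nat \<Rightarrow> real ^ 'n) \<Rightarrow> nat \<Rightarrow> nat \<Rightarrow> real" where
  "hist_max p f x r t = Max {f (x j) | j. r \<le> j \<and> j \<le> t \<and> t < j + hist_len p}"

definition pg_point ::
    "(real ^ 'n) set \<Rightarrow> (real ^ 'n \<Rightarrow> real ^ 'n) \<Rightarrow> real ^ 'n \<Rightarrow> real \<Rightarrow> real ^ 'n" where
  "pg_point C g x a = closest_point C (x - a *\<^sub>R g x)"

definition pg_next ::
    "hybrid_params \<Rightarrow> (real ^ 'n) set \<Rightarrow> (real ^ 'n \<Rightarrow> real) \<Rightarrow> (real ^ 'n \<Rightarrow> real ^ 'n) \<Rightarrow>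
     (nat \<Rightarrow> real ^ 'n) \<Rightarrow> nat \<Rightarrow> nat \<Rightarrow> real ^ 'n" where
  "pg_next p C f g x r t =
     (let \<alpha> = spectral_step p g x t;
          k = (LEAST k. f (pg_point C g (x t) (eta p ^ k * \<alpha>)) \<le> hist_max p f x r t +
                 gamma p * (g (x t) \<bullet> (pg_point C g (x t) (eta p ^ k * \<alpha>) - x t)))
      in pg_point C g (x t) (eta p ^ k * \<alpha>))"

text \<open>\<open>H t\<close> is the model at iteration \<open>t\<close> (\<^term>\<open>None\<close> if there is none), \<open>B t\<close> the basis matrix
  it refers to, \<open>S t\<close> the list of all pairs collected since its initialization, and \<open>r t\<close> as for
  \<^const>\<open>hist_max\<close>. \<open>B t\<close> and \<open>S t\<close> are irrelevant when \<open>H t\<close> is \<^term>\<open>None\<close>.\<close>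

definition hybrid_move ::
    "hybrid_params \<Rightarrow> (real ^ 'n) set \<Rightarrow> (real ^ 'n \<Rightarrow> real) \<Rightarrow> (real ^ 'n \<Rightarrow> real ^ 'n) \<Rightarrow>
     (nat \<Rightarrow> real ^ 'n) \<Rightarrow> (nat \<Rightarrow> real Matrix.mat option) \<Rightarrow> (nat \<Rightarrow> (real ^ 'n) list) \<Rightarrow>
     (nat \<Rightarrow> nat) \<Rightarrow> nat \<Rightarrow> bool" where
  "hybrid_move p C f g x H B r t \<longleftrightarrow>
     (\<exists>Ht. H t = Some Ht \<and> qn_step p C f g (x t) (qn_direction (B t) Ht (g (x t))) (x (Suc t)) \<and>
        r (Suc t) = Suc t) \<or>
     (x (Suc t) = pg_next p C f g x (r t) t \<and> r (Suc t) = r t)"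

definition model_update ::
    "hybrid_params \<Rightarrow> (real ^ 'n) set \<Rightarrow> (real ^ 'n \<Rightarrow> real ^ 'n) \<Rightarrow>
     ((real ^ 'n) set \<Rightarrow> (real ^ 'n) list) \<Rightarrow>
     (nat \<Rightarrow> real ^ 'n) \<Rightarrow> (nat \<Rightarrow> real Matrix.mat option) \<Rightarrow> (nat \<Rightarrow> (real ^ 'n) list) \<Rightarrow>
     (nat \<Rightarrow> (real Matrix.vec \<times> real Matrix.vec) list) \<Rightarrow> nat \<Rightarrow> bool" where
  "model_update p C g \<Phi> x H B S t \<longleftrightarrow>
     (let x' = x (Suc t); F = face_at C x';
          pair = (reduce_vec (B (Suc t)) (x' - x t), reduce_vec (B (Suc t)) (g x' - g (x t)))
      in if F = face_at C (x t) \<and> - g x' \<in> self_proj C F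
         then B (Suc t) = (if H t = None then \<Phi> F else B t) \<and>
              S (Suc t) = (if H t = None then [] else S t) @ [pair] \<and>
              H (Suc t) = Some (lbfgs_mat (memory p) (mu p) (length (B (Suc t))) (S (Suc t)))
         else H (Suc t) = None)"

text \<open>The line search may fail at any iteration, and at a stationary iterate the algorithm may or
  may not stop; hence a relation rather than a function.\<close>

definition hybrid_run ::
    "hybrid_params \<Rightarrow> (real ^ 'n) set \<Rightarrow> (real ^ 'n \<Rightarrow> real) \<Rightarrow> (real ^ 'n \<Rightarrow> real ^ 'n) \<Rightarrow>
     ((real ^ 'n) set \<Rightarrow> (real ^ 'n) list) \<Rightarrow> real ^ 'n \<Rightarrow> (nat \<Rightarrow> real ^ 'n) \<Rightarrow> bool" where
  "hybrid_run p C f g \<Phi> x0 x \<longleftrightarrow>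
     (\<exists>H B S r. x 0 = x0 \<and> H 0 = None \<and> r 0 = 0 \<and>
        (\<forall>t. (closest_point C (x t - g (x t)) = x t \<and> (\<forall>s \<ge> t. x s = x t)) \<or>
             (hybrid_move p C f g x H B r t \<and> model_update p C g \<Phi> x H B S t)))"

end

theory Submission
  imports Defs
begin

text \<open>Let \<open>z\<close> be the minimizer of \<open>f\<close> over \<open>C\<close> and \<open>e\<^sub>t = f (x\<^sub>t) - f z\<close>. The proof shows that the objective
  gap converges to zero at a linear rate: there is one constant \<open>q < 1\<close> with
  \<open>e\<^sub>t\<^sub>+\<^sub>1 \<le> q * e\<^sub>j\<close> for some \<open>j\<close> among the last \<open>M\<close> indices, whichever kind of step is taken at \<open>t\<close>.
  Iterating such a windowed contraction drives \<open>e\<^sub>t\<close> to zero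
  (\<open>windowed_contraction_tendsto_0\<close>), however the two kinds of step alternate and whenever the history
  is reset. Quadratic growth, \<open>e\<^sub>t \<ge> (\<mu>\<^sub>1 / 4) \<parallel>x\<^sub>t - z\<parallel>\<^sup>2\<close>, then gives convergence of the iterates.

  Both kinds of step contract for the same reason. An optimality estimate \<open>e \<le> A \<parallel>x - z\<parallel>\<close>, together
  with quadratic growth, improves itself to \<open>e \<le> (4 / \<mu>\<^sub>1) A\<^sup>2\<close> (\<open>gap_le_of_linear_bound\<close>), and the line
  search guarantees a decrease proportional to \<open>A\<^sup>2\<close>.

  In a projected-gradient step from \<open>x\<close> to \<open>x'\<close>, the variational inequality of the projection gives
  such an estimate at the new point with \<open>A\<close> proportional to \<open>\<parallel>x' - x\<parallel>\<close>. The acceptance test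
  decreases the objective by a multiple of \<open>\<parallel>x' - x\<parallel>\<^sup>2\<close> below the history maximum, because
  backtracking leaves the step length in a fixed interval away from zero (\<open>pg_next_contraction\<close>).

  In a quasi-Newton step, \<open>A\<close> is the norm of the gradient projected onto the directions of the current
  face. This is where the self-projection cone enters: for \<open>- g x\<close> in that cone, the part of the
  gradient orthogonal to the face is the negative of a normal vector of \<open>C\<close>; no point of \<open>C\<close> is
  downhill with respect to it, so that the projected part alone bounds the gap (\<open>self_proj_slope_le\<close>). The Wolfe
  conditions give a decrease proportional to the square of the projected gradient
  (\<open>wolfe_decrease\<close>), provided that the reduced inverse Hessians are uniformly bounded and positive
  definite. They are, because each is obtained from \<open>\<mu> I\<close> by at most \<open>N\<close> updates, and an update with a
  pair that satisfies the curvature inequalities of \<open>f\<close> worsens the bounds by a controlled amount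
  (\<open>lbfgs_mat_uniform_bounds\<close>).\<close>

section \<open>Smooth strongly convex functions\<close>

text \<open>The two quadratic bounds encode the bounds on the Hessian: monotonicity, cocoercivity and Lipschitz
  continuity of the gradient all follow from them.\<close>

locale smooth_strongly_convex =
  fixes f :: "'a::euclidean_space \<Rightarrow> real" and g :: "'a \<Rightarrow> 'a" and m L :: real
  assumes m_pos: "0 < m" and m_le_L: "m \<le> L"
    and lower: "f u + g u \<bullet> (v - u) + m / 2 * (norm (v - u))\<^sup>2 \<le> f v"
    and upper: "f v \<le> f u + g u \<bullet> (v - u) + L / 2 * (norm (v - u))\<^sup>2"
begin

lemma L_pos: "0 < L"
  using m_pos m_le_L by linarith

lemma gradient_inequality: "f u + g u \<bullet> (v - u) \<le> f v"
proof -
  have "0 \<le> m / 2 * (norm (v - u))\<^sup>2"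
    using m_pos by simp
  then show ?thesis
    using lower[of u v] by linarith
qed

lemma strongly_monotone: "m * (norm (v - u))\<^sup>2 \<le> (g v - g u) \<bullet> (v - u)"
proof -
  have "g v \<bullet> (u - v) = - (g v \<bullet> (v - u))"
    by (simp add: inner_diff_right)
  then show ?thesis
    using lower[of u v] lower[of v u] by (simp add: inner_diff_left norm_minus_commute[of u v])
qed

lemma gradient_difference_le: "(g v - g u) \<bullet> (v - u) \<le> L * (norm (v - u))\<^sup>2"
proof -
  have "g v \<bullet> (u - v) = - (g v \<bullet> (v - u))"
    by (simp add: inner_diff_right)
  then show ?thesis
    using upper[of u v] upper[of v u] by (simp add: inner_diff_left norm_minus_commute[of u v])
qed

text \<open>The function \<open>f - g u \<bullet> _\<close> is minimal at \<open>u\<close>. One gradient step of length \<open>1 / L\<close> from \<open>v\<close>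
  decreases it by at least \<open>(norm (g v - g u))\<^sup>2 / (2 * L)\<close>, and the result is still at least the minimum.\<close>

lemma gradient_gap: "f u + g u \<bullet> (v - u) + (norm (g v - g u))\<^sup>2 / (2 * L) \<le> f v"
proof -
  define h where "h = g v - g u"
  define w where "w = v - (1 / L) *\<^sub>R h"
  have "f u + g u \<bullet> (w - u) \<le> f v + g v \<bullet> (w - v) + L / 2 * (norm (w - v))\<^sup>2"
    using gradient_inequality[of u w] upper[of w v] by linarith
  moreover have "g u \<bullet> (w - u) = g u \<bullet> (v - u) - (g u \<bullet> h) / L"
    by (simp add: w_def inner_diff_right)
  moreover have "g v \<bullet> (w - v) = - (g v \<bullet> h) / L"
    by (simp add: w_def)
  moreover have "(norm (w - v))\<^sup>2 = (norm h)\<^sup>2 / L\<^sup>2"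
    by (simp add: w_def power_divide)
  moreover have "g v \<bullet> h - g u \<bullet> h = (norm h)\<^sup>2"
    by (simp add: h_def power2_norm_eq_inner inner_diff_left inner_diff_right)
  then have "(g v \<bullet> h) / L - (g u \<bullet> h) / L = (norm h)\<^sup>2 / L"
    by (metis diff_divide_distrib)
  moreover have "L / 2 * ((norm h)\<^sup>2 / L\<^sup>2) = (norm h)\<^sup>2 / L - (norm h)\<^sup>2 / (2 * L)"
    using L_pos by (simp add: field_simps power2_eq_square)
  ultimately show ?thesis
    unfolding h_def[symmetric] by simp
qed

text \<open>The sum of \<open>gradient_gap\<close> and its copy with \<open>u\<close> and \<open>v\<close> exchanged. This form of smoothness
  survives projection of the gradient difference onto a subspace, which makes it the right one for
  the quasi-Newton pairs.\<close>

lemma cocoercive: "(norm (g v - g u))\<^sup>2 \<le> L * ((g v - g u) \<bullet> (v - u))"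
proof -
  have "g v \<bullet> (u - v) = - (g v \<bullet> (v - u))"
    by (simp add: inner_diff_right)
  then have "(norm (g v - g u))\<^sup>2 / L \<le> (g v - g u) \<bullet> (v - u)"
    using gradient_gap[of u v] gradient_gap[of v u] 
    by (simp add: inner_diff_left norm_minus_commute[of "g u"])
  then show ?thesis
    using L_pos by (simp add: field_simps)
qed

lemma gradient_lipschitz: "norm (g v - g u) \<le> L * norm (v - u)"
proof -
  have "(norm (g v - g u))\<^sup>2 \<le> L * ((g v - g u) \<bullet> (v - u))"
    by (rule cocoercive)
  also have "\<dots> \<le> L * (L * (norm (v - u))\<^sup>2)"
    using gradient_difference_le L_pos by (intro mult_left_mono) auto
  also have "\<dots> = (L * norm (v - u))\<^sup>2"
    by (simp add: power_mult_distrib power2_eq_square)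
  finally show ?thesis
    by (rule power2_le_imp_le) (use L_pos in simp)
qed

text \<open>The midpoint of \<open>x\<close> and \<open>z\<close> lies in \<open>C\<close>, so its value is at least \<open>f z\<close>. The sum of the lower
  bounds for \<open>f x\<close> and \<open>f z\<close> at the midpoint then gives the claim.\<close>

lemma quadratic_growth:
  assumes "convex C" "x \<in> C" "z \<in> C" and min: "\<And>y. y \<in> C \<Longrightarrow> f z \<le> f y"
  shows "m / 4 * (norm (x - z))\<^sup>2 \<le> f x - f z"
proof -
  define w where "w = (1/2) *\<^sub>R x + (1/2) *\<^sub>R z"
  have "w \<in> C"
    unfolding w_def using assms by (intro convexD) auto
  have half: "a - ((1/2) *\<^sub>R a + (1/2) *\<^sub>R b) = (1/2) *\<^sub>R (a - b)" for a b :: 'a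
  proof -
    have "a - ((1/2) *\<^sub>R a + (1/2) *\<^sub>R b) = (1 - 1/2) *\<^sub>R a - (1/2) *\<^sub>R b"
      unfolding scaleR_left_diff_distrib by simp
    then show ?thesis
      by (simp add: scaleR_right_diff_distrib)
  qed
  have xw: "x - w = (1/2) *\<^sub>R (x - z)"
    unfolding w_def by (rule half)
  have zw: "z - w = - ((1/2) *\<^sub>R (x - z))"
    unfolding w_def using half[of z x] by (simp add: add.commute scaleR_right_diff_distrib)
  have "f w + (g w \<bullet> (x - z)) / 2 + m / 2 * ((norm (x - z))\<^sup>2 / 4) \<le> f x"
    using lower[of w x] unfolding xw by (simp add: power_divide)
  moreover have "f w - (g w \<bullet> (x - z)) / 2 + m / 2 * ((norm (x - z))\<^sup>2 / 4) \<le> f z"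
    using lower[of w z] unfolding zw by (simp add: power_divide)
  ultimately show ?thesis
    using min[OF \<open>w \<in> C\<close>] by (simp add: field_simps)
qed

end

text \<open>Second-order Taylor expansion along segments.\<close>

lemma smooth_strongly_convex_of_hessian:
  fixes f :: "real ^ 'n \<Rightarrow> real" and Hess :: "real ^ 'n \<Rightarrow> real ^ 'n ^ 'n"
  assumes grad: "\<And>u. GDERIV f u :> g u"
    and hess: "\<And>u. (g has_derivative (\<lambda>v. Hess u *v v)) (at u)"
    and "0 < m" "m \<le> L"
    and lo: "\<And>u v. m * (norm v)\<^sup>2 \<le> v \<bullet> (Hess u *v v)"
    and up: "\<And>u v. v \<bullet> (Hess u *v v) \<le> L * (norm v)\<^sup>2"
  shows "smooth_strongly_convex f g m L"
proof -
  have taylor: "\<exists>w. f v = f u + g u \<bullet> (v - u) + (v - u) \<bullet> (Hess w *v (v - u)) / 2" for u v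
  proof -
    define d where "d = v - u"
    define D where "D k t = (if k = 0 then f (u + t *\<^sub>R d) else if k = 1 then g (u + t *\<^sub>R d) \<bullet> d
       else d \<bullet> (Hess (u + t *\<^sub>R d) *v d))" for k :: nat and t
    have line: "((\<lambda>t. u + t *\<^sub>R d) has_derivative (\<lambda>h. h *\<^sub>R d)) (at t)" for t
      by (auto intro!: derivative_eq_intros)
    have D0: "D 0 = (\<lambda>t. f (u + t *\<^sub>R d))" and D1: "D (Suc 0) = (\<lambda>t. g (u + t *\<^sub>R d) \<bullet> d)"
      by (simp_all add: D_def fun_eq_iff)
    have "DERIV (D 0) t :> D (Suc 0) t" for t
    proof -
      have "(f has_derivative (\<lambda>h. h \<bullet> g (u + t *\<^sub>R d))) (at (u + t *\<^sub>R d))"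
        using grad unfolding gderiv_def by simp
      from has_derivative_compose[OF line this]
      show ?thesis
        unfolding D0 has_field_derivative_def by (simp add: D_def inner_commute mult_commute_abs)
    qed
    moreover have "DERIV (D (Suc 0)) t :> D (Suc (Suc 0)) t" for t
    proof -
      have "((\<lambda>t. g (u + t *\<^sub>R d) \<bullet> d) has_derivative (\<lambda>h. (Hess (u + t *\<^sub>R d) *v (h *\<^sub>R d)) \<bullet> d)) (at t)"
        using has_derivative_compose[OF line hess] by (rule has_derivative_inner_left)
      moreover have "(\<lambda>h. (Hess (u + t *\<^sub>R d) *v (h *\<^sub>R d)) \<bullet> d) = (*) (D (Suc (Suc 0)) t)"
        by (rule ext) (simp add: D_def matrix_vector_mult_scaleR inner_commute[of d])
      ultimately show ?thesis
        unfolding D1 has_field_derivative_def by simp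
    qed
    ultimately have "\<forall>k t. k < 2 \<and> 0 \<le> t \<and> t \<le> 1 \<longrightarrow> DERIV (D k) t :> D (Suc k) t"
      by (auto simp: less_2_cases_iff)
    from Maclaurin[of 1 2 D "D 0", OF _ _ _ this]
    obtain t where "D 0 1 = (\<Sum>k<2. D k 0 / fact k * 1 ^ k) + D 2 t / fact 2 * 1\<^sup>2"
      by auto
    then have "f v = f u + g u \<bullet> d + d \<bullet> (Hess (u + t *\<^sub>R d) *v d) / 2"
      by (simp add: D_def numeral_2_eq_2 d_def)
    then show ?thesis
      unfolding d_def by blast
  qed
  show ?thesis
  proof
    fix u v
    obtain w where w: "f v = f u + g u \<bullet> (v - u) + (v - u) \<bullet> (Hess w *v (v - u)) / 2"
      using taylor by blast
    show "f u + g u \<bullet> (v - u) + m / 2 * (norm (v - u))\<^sup>2 \<le> f v"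
      using lo[of "v - u" w] w by simp
    show "f v \<le> f u + g u \<bullet> (v - u) + L / 2 * (norm (v - u))\<^sup>2"
      using up[of "v - u" w] w by simp
  qed fact+
qed

text \<open>The lower quadratic bound at \<open>c\<close> makes \<open>f\<close> at least \<open>f c\<close> outside the ball of radius
  \<open>2 * norm (g c) / m\<close>, so that the search for a minimizer takes place in a compact set.\<close>

lemma (in smooth_strongly_convex) minimizer_exists:
  assumes "closed C" and c: "c \<in> C" and cont: "continuous_on UNIV f"
  obtains z where "z \<in> C" "\<And>y. y \<in> C \<Longrightarrow> f z \<le> f y"
proof -
  define r where "r = 2 * norm (g c) / m"
  have "0 \<le> r"
    using m_pos by (simp add: r_def)
  have far: "f c \<le> f y" if "r < norm (y - c)" for y
  proof -
    have "norm (g c) \<le> m / 2 * norm (y - c)"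
      using that m_pos by (simp add: r_def field_simps)
    then have "norm (g c) * norm (y - c) \<le> m / 2 * norm (y - c) * norm (y - c)"
      by (rule mult_right_mono) simp
    then show ?thesis
      using lower[of c y] Cauchy_Schwarz_ineq2[of "g c" "y - c"]
      by (simp add: power2_eq_square)
  qed
  have "c \<in> C \<inter> cball c r"
    using c \<open>0 \<le> r\<close> by simp
  moreover have "compact (C \<inter> cball c r)"
    using closed_Int_compact[OF \<open>closed C\<close> compact_cball] .
  moreover have "continuous_on (C \<inter> cball c r) f"
    using cont continuous_on_subset by blast
  ultimately obtain z where z: "z \<in> C \<inter> cball c r" "\<And>y. y \<in> C \<inter> cball c r \<Longrightarrow> f z \<le> f y"
    using continuous_attains_inf[of "C \<inter> cball c r" f] by blast
  have "f z \<le> f y" if "y \<in> C" for y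
  proof (cases "r < norm (y - c)")
    case True
    then show ?thesis
      using far[OF True] z(2)[OF \<open>c \<in> C \<inter> cball c r\<close>] by linarith
  next
    case False
    then show ?thesis
      using that z(2)[of y] by (simp add: dist_norm norm_minus_commute)
  qed
  then show thesis
    using that z(1) by blast
qed

section \<open>Nonmonotone linear convergence\<close>

text \<open>The gap need not decrease from one iterate to the next, but each full window of length \<open>M\<close>
  gains a factor \<open>q\<close>: \<open>e t \<le> q ^ i * e 0\<close> as soon as \<open>t \<ge> i * M\<close>.\<close>

lemma windowed_contraction_tendsto_0:
  fixes e :: "nat \<Rightarrow> real"
  assumes nonneg: "\<And>t. 0 \<le> e t" and "0 \<le> q" "q < 1"
    and step: "\<And>t. \<exists>j\<le>t. t < j + M \<and> e (Suc t) \<le> q * e j"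
  shows "e \<longlonglongrightarrow> 0"
proof -
  have bound: "e t \<le> q ^ i * e 0" if "i * M \<le> t" for i t
    using that
  proof (induction i arbitrary: t)
    case 0
    show ?case
    proof (induction t rule: less_induct)
      case (less t)
      show ?case
      proof (cases t)
        case (Suc s)
        obtain j where "j \<le> s" "e (Suc s) \<le> q * e j"
          using step by blast
        moreover have "q * e j \<le> 1 * e j"
          using \<open>q < 1\<close> nonneg by (intro mult_right_mono) auto
        ultimately show ?thesis
          using less.IH[of j] Suc by simp
      qed simp
    qed
  next
    case (Suc i)
    obtain j where j: "j \<le> 0 \<and> 0 < j + M"
      using step[of 0] by blast
    then obtain s where s: "t = Suc s"
      using Suc.prems by (cases t) auto
    obtain j where j: "j \<le> s" "s < j + M" "e t \<le> q * e j"
      using step s by blast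
    have "i * M \<le> j"
      using j Suc.prems s by simp
    then have "q * e j \<le> q * (q ^ i * e 0)"
      using Suc.IH \<open>0 \<le> q\<close> by (intro mult_left_mono) auto
    with j show ?case
      by simp
  qed
  have "M > 0"
    using step[of 0] by auto
  have "(\<lambda>i. q ^ i * e 0) \<longlonglongrightarrow> 0"
    using \<open>0 \<le> q\<close> \<open>q < 1\<close> by (intro tendsto_mult_left_zero LIMSEQ_realpow_zero)
  moreover have "filterlim (\<lambda>t. t div M) sequentially sequentially"
    unfolding filterlim_at_top eventually_sequentially
  proof
    fix i
    show "\<exists>N. \<forall>t\<ge>N. i \<le> t div M"
      using \<open>M > 0\<close> by (intro exI[of _ "i * M"]) (simp add: less_eq_div_iff_mult_less_eq)
  qed
  ultimately have "(\<lambda>t. q ^ (t div M) * e 0) \<longlonglongrightarrow> 0"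
    by (rule filterlim_compose)
  then show ?thesis
    by (rule tendsto_sandwich[OF _ _ tendsto_const, rotated 2])
      (auto intro!: always_eventually nonneg bound)
qed

section \<open>Projected-gradient steps\<close>

context smooth_strongly_convex
begin

text \<open>Quadratic growth and the bound combine to \<open>m / 4 * norm (x - z) \<le> A\<close>; inserting this into the
  bound makes the estimate quadratic in \<open>A\<close>.\<close>

lemma gap_le_of_linear_bound:
  assumes "convex C" "x \<in> C" "z \<in> C" and min: "\<And>y. y \<in> C \<Longrightarrow> f z \<le> f y"
    and bound: "f x - f z \<le> A * norm (x - z)" and "0 \<le> A"
  shows "f x - f z \<le> 4 / m * A\<^sup>2"
proof -
  have growth: "m / 4 * (norm (x - z))\<^sup>2 \<le> f x - f z"
    using assms by (intro quadratic_growth)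
  have "norm (x - z) \<le> 4 / m * A"
  proof (cases "x = z")
    case True
    then show ?thesis
      using m_pos \<open>0 \<le> A\<close> by simp
  next
    case False
    have "m / 4 * norm (x - z) * norm (x - z) \<le> A * norm (x - z)"
      using growth bound by (simp add: power2_eq_square)
    then have "m / 4 * norm (x - z) \<le> A"
      using False by (simp add: mult_le_cancel_right)
    then show ?thesis
      using m_pos by (simp add: field_simps)
  qed
  then have "A * norm (x - z) \<le> A * (4 / m * A)"
    using \<open>0 \<le> A\<close> by (rule mult_left_mono)
  then show ?thesis
    using bound by (simp add: power2_eq_square mult.commute mult.left_commute)
qed

context
  fixes C :: "'a set" and x x' :: 'a and a :: real
  assumes C: "closed C" "convex C" and x: "x \<in> C" and "0 < a"
    and x': "x' = closest_point C (x - a *\<^sub>R g x)"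
begin

lemma projected_point_in_set: "x' \<in> C"
  using C x x' closest_point_in_set by blast

lemma projected_variational_inequality:
  assumes "y \<in> C"
  shows "a * (g x \<bullet> (x' - y)) \<le> (x - x') \<bullet> (x' - y)"
proof -
  have "(x - a *\<^sub>R g x - x') \<bullet> (y - x') \<le> 0"
    unfolding x' using C assms by (intro closest_point_dot)
  then show ?thesis
    by (simp add: inner_diff_left inner_diff_right algebra_simps)
qed

lemma projected_step_slope: "g x \<bullet> (x' - x) \<le> - (norm (x' - x))\<^sup>2 / a"
proof -
  have "a * (g x \<bullet> (x' - x)) \<le> - (norm (x' - x))\<^sup>2"
    using projected_variational_inequality[OF x]
    by (simp add: power2_norm_eq_inner inner_diff_left inner_diff_right algebra_simps)
  then show ?thesis
    using \<open>0 < a\<close> by (simp add: field_simps)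
qed

text \<open>The slope along the projected step is at most \<open>- (norm (x' - x))\<^sup>2 / a\<close>, so for small \<open>a\<close> the
  fraction \<open>1 - c\<close> of it dominates the quadratic error term. Hence backtracking terminates, and
  never goes far below \<open>2 * (1 - c) / L\<close>.\<close>

lemma projected_step_sufficient_decrease:
  assumes "c < 1" and small: "a \<le> 2 * (1 - c) / L"
  shows "f x' \<le> f x + c * (g x \<bullet> (x' - x))"
proof -
  have "L / 2 \<le> (1 - c) / a"
    using small \<open>0 < a\<close> L_pos by (simp add: field_simps)
  then have "L / 2 * (norm (x' - x))\<^sup>2 \<le> (1 - c) / a * (norm (x' - x))\<^sup>2"
    by (rule mult_right_mono) simp
  moreover have "(1 - c) * (g x \<bullet> (x' - x)) \<le> (1 - c) * (- (norm (x' - x))\<^sup>2 / a)"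
    using projected_step_slope \<open>c < 1\<close> by (intro mult_left_mono) auto
  then have "(1 - c) / a * (norm (x' - x))\<^sup>2 \<le> - ((1 - c) * (g x \<bullet> (x' - x)))"
    by simp
  moreover have "- ((1 - c) * (g x \<bullet> (x' - x))) = c * (g x \<bullet> (x' - x)) - g x \<bullet> (x' - x)"
    by (simp add: left_diff_distrib)
  ultimately show ?thesis
    using upper[of x' x] by linarith
qed

text \<open>The gap at the new point is at most \<open>g x' \<bullet> (x' - z)\<close>. Replacing \<open>g x'\<close> by \<open>g x\<close> costs
  \<open>L * norm (x' - x)\<close> by Lipschitz continuity, and the remaining term is controlled by the
  variational inequality.\<close>

lemma projected_step_gap:
  assumes z: "z \<in> C" and min: "\<And>y. y \<in> C \<Longrightarrow> f z \<le> f y"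
  shows "f x' - f z \<le> 4 / m * (L + 1 / a)\<^sup>2 * (norm (x' - x))\<^sup>2"
proof -
  have "f x' - f z \<le> g x' \<bullet> (x' - z)"
    using gradient_inequality[of x' z] by (simp add: inner_diff_right)
  also have "\<dots> = (g x' - g x) \<bullet> (x' - z) + g x \<bullet> (x' - z)"
    by (simp add: inner_diff_left)
  also have "(g x' - g x) \<bullet> (x' - z) \<le> L * norm (x' - x) * norm (x' - z)"
    using norm_cauchy_schwarz[of "g x' - g x" "x' - z"]
      mult_right_mono[OF gradient_lipschitz[of x' x], of "norm (x' - z)"] by simp
  also have "g x \<bullet> (x' - z) \<le> 1 / a * norm (x' - x) * norm (x' - z)"
    using projected_variational_inequality[OF z] norm_cauchy_schwarz[of "x - x'" "x' - z"] \<open>0 < a\<close>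
    by (simp add: field_simps norm_minus_commute)
  finally have "f x' - f z \<le> (L + 1 / a) * norm (x' - x) * norm (x' - z)"
    by (simp add: algebra_simps)
  then have "f x' - f z \<le> 4 / m * ((L + 1 / a) * norm (x' - x))\<^sup>2"
    using C projected_point_in_set z min L_pos \<open>0 < a\<close>
    by (intro gap_le_of_linear_bound) auto
  then show ?thesis
    by (simp add: power_mult_distrib)
qed

end

end

section \<open>Faces and the self-projection cone\<close>

text \<open>A face of least dimension among those containing \<open>x\<close> has \<open>x\<close> in its relative interior, since the
  relative boundary of a polyhedron is covered by its facets.\<close>

lemma ex1_face_containing_in_rel_interior:
  fixes C :: "'a::euclidean_space set"
  assumes "polyhedron C" "x \<in> C"
  shows "\<exists>!F. F face_of C \<and> x \<in> rel_interior F"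
proof -
  define G where "G = {F. F face_of C \<and> x \<in> F}"
  have "G \<noteq> {}"
    using assms face_of_refl[OF polyhedron_imp_convex] by (auto simp: G_def)
  then obtain F where F: "F \<in> G" and least: "\<And>F'. F' \<in> G \<Longrightarrow> nat (aff_dim F) \<le> nat (aff_dim F')"
    using ex_has_least_nat[of "\<lambda>F. F \<in> G" _ "\<lambda>F. nat (aff_dim F)"] by blast
  have "x \<in> rel_interior F"
  proof (rule ccontr)
    assume "x \<notin> rel_interior F"
    moreover have "polyhedron F"
      using F assms face_of_polyhedron_polyhedron by (auto simp: G_def)
    ultimately obtain F' where F': "F' facet_of F" "x \<in> F'"
      using F rel_boundary_of_polyhedron[of F] by (auto simp: G_def)
    then have "F' \<in> G"
      using F facet_of_imp_face_of face_of_trans unfolding G_def by blast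
    moreover have "aff_dim F' = aff_dim F - 1" "0 \<le> aff_dim F'"
      using F' aff_dim_negative_iff[of F'] by (auto simp: facet_of_def not_less)
    ultimately show False
      using least[of F'] by simp
  qed
  then show ?thesis
    using F face_of_eq by (intro ex1I[of _ F]) (auto simp: G_def)
qed

lemma face_at_polyhedron:
  assumes "polyhedron C" "x \<in> C"
  shows "face_at C x face_of C" "x \<in> rel_interior (face_at C x)"
  using theI'[OF ex1_face_containing_in_rel_interior[OF assms]] by (auto simp: face_at_def)

text \<open>From a relative interior point \<open>y\<close> the segment from \<open>w\<close> to \<open>y\<close> extends beyond \<open>y\<close> inside \<open>F\<close>, which
  gives the reverse of the inequality \<open>le\<close>.\<close>

lemma rel_interior_normal_orthogonal:
  fixes F :: "'a::euclidean_space set"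
  assumes "convex F" "y \<in> rel_interior F" and le: "\<And>w. w \<in> F \<Longrightarrow> u \<bullet> (w - y) \<le> 0" and "w \<in> F"
  shows "u \<bullet> (w - y) = 0"
proof -
  obtain e where e: "e > 1" "(1 - e) *\<^sub>R w + e *\<^sub>R y \<in> F"
    using convex_rel_interior_if2[OF assms(1,2)] \<open>w \<in> F\<close> hull_inc by metis
  have "(1 - e) *\<^sub>R w + e *\<^sub>R y - y = (1 - e) *\<^sub>R (w - y)"
    by (simp add: algebra_simps)
  then have "(1 - e) * (u \<bullet> (w - y)) \<le> 0"
    using le[OF e(2)] by simp
  then have "0 \<le> u \<bullet> (w - y)"
    using e(1) by (simp add: mult_le_0_iff)
  with le[OF \<open>w \<in> F\<close>] show ?thesis
    by simp
qed

lemma lift_reduce_vec: "lift_vec B (reduce_vec B v) = (\<Sum>i<length B. (B ! i \<bullet> v) *\<^sub>R B ! i)"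
  by (simp add: lift_vec_def reduce_vec_def)

lemma lift_reduce_vec_in_span:
  assumes "orthonormal_columns B V" "v \<in> V"
  shows "lift_vec B (reduce_vec B v) = v"
proof -
  have lin: "linear (\<lambda>v. \<Sum>i<length B. (B ! i \<bullet> v) *\<^sub>R B ! i)"
    by (rule linearI) (simp_all add: inner_add_right scaleR_left_distrib sum.distrib scaleR_sum_right)
  have "(\<Sum>i<length B. (B ! i \<bullet> b) *\<^sub>R B ! i) = b" if "b \<in> set B" for b
  proof -
    obtain j where j: "j < length B" "b = B ! j"
      using \<open>b \<in> set B\<close> by (auto simp: in_set_conv_nth)
    have "(\<Sum>i<length B. (B ! i \<bullet> b) *\<^sub>R B ! i) = (\<Sum>i<length B. if i = j then B ! j else 0)"
      using assms(1) j by (intro sum.cong) (auto simp: orthonormal_columns_def)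
    then show ?thesis
      using j by simp
  qed
  then have "(\<Sum>i<length B. (B ! i \<bullet> v) *\<^sub>R B ! i) = id v"
    using linear_eq_on_span[OF lin linear_id, of "set B" v] assms
    by (simp add: orthonormal_columns_def)
  then show ?thesis
    by (simp add: lift_reduce_vec)
qed

text \<open>Split \<open>- v\<close> as \<open>n + d\<close> with \<open>n\<close> normal to \<open>C\<close> and \<open>d\<close> a direction of \<open>F\<close>. The normal part is
  orthogonal to \<open>F\<close>, so \<open>- d\<close> is the projection of \<open>v\<close> onto the directions of \<open>F\<close>, and
  \<open>n \<bullet> (z - x) \<le> 0\<close>, so that the bound comes from \<open>d\<close> alone. For the gradient \<open>v\<close> at \<open>x\<close>
  this bounds the gap by the projected gradient, which therefore vanishes only at a minimizer.\<close>

lemma self_proj_slope_le: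
  fixes C :: "(real ^ 'n) set"
  assumes C: "closed C" "convex C" and F: "F face_of C" and x: "x \<in> rel_interior F"
    and neg_g: "- v \<in> self_proj C F" and B: "orthonormal_columns B (diff_hull F)" and z: "z \<in> C"
  shows "v \<bullet> (x - z) \<le> norm (lift_vec B (reduce_vec B v)) * norm (x - z)"
proof -
  define y where "y = (SOME y. y \<in> rel_interior F)"
  \<comment> \<open>The normal part of the splitting is normal at the chosen point \<open>y\<close>, which may differ from \<open>x\<close>.\<close>
  obtain n d where nd: "- v = n + d" and n: "closest_point C (y + n) = y" and d: "d \<in> diff_hull F"
    using neg_g by (auto simp: self_proj_def normal_cone_face_def normal_cone_at_def y_def)
  have y: "y \<in> rel_interior F"
    unfolding y_def using x by (rule someI)
  have n_le: "n \<bullet> (w - y) \<le> 0" if "w \<in> C" for w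
    using closest_point_dot[OF C(2,1) that, of "y + n"] by (simp add: n)
  have n_eq: "n \<bullet> (w - y) = 0" if "w \<in> F" for w
    using F y that n_le face_of_imp_subset[OF F]
    by (intro rel_interior_normal_orthogonal[of F]) (auto simp: face_of_imp_convex)
  have "n \<bullet> b = 0" if "b \<in> diff_hull F" for b
    using that unfolding diff_hull_def
  proof (rule span_induct)
    show "n \<bullet> b = 0" if "b \<in> {u1 - u2 |u1 u2. u1 \<in> F \<and> u2 \<in> F}" for b
      using that n_eq by (force simp: inner_diff_right)
  qed (simp add: subspace_hyperplane)
  then have "B ! i \<bullet> n = 0" if "i < length B" for i
    using that B span_base[OF nth_mem, of i B] by (simp add: orthonormal_columns_def inner_commute[of _ n])
  moreover have "v = - n - d"
    using nd by (simp add: minus_equation_iff[of v])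
  ultimately have "B ! i \<bullet> v = B ! i \<bullet> (- d)" if "i < length B" for i
    using that by (simp add: inner_diff_right)
  then have "lift_vec B (reduce_vec B v) = lift_vec B (reduce_vec B (- d))"
    by (simp add: lift_reduce_vec)
  also have "\<dots> = - d"
    using d by (intro lift_reduce_vec_in_span[OF B]) (auto simp: diff_hull_def span_neg)
  finally have norm_eq: "norm (lift_vec B (reduce_vec B v)) = norm d"
    by simp
  have "v \<bullet> (x - z) = n \<bullet> (z - y) - n \<bullet> (x - y) - d \<bullet> (x - z)"
    unfolding \<open>v = - n - d\<close> by (simp add: inner_diff_right inner_diff_left)
  also have "n \<bullet> (x - y) = 0"
    using n_eq x rel_interior_subset by blast
  also have "n \<bullet> (z - y) - 0 - d \<bullet> (x - z) \<le> norm d * norm (x - z)"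
    using n_le[OF z] Cauchy_Schwarz_ineq2[of d "x - z"] by linarith
  finally show ?thesis
    by (simp add: norm_eq)
qed

section \<open>Limited-memory BFGS matrices\<close>

lemma lift_vec_inner: "lift_vec B u \<bullet> v = scalar_prod u (reduce_vec B v)"
  by (simp add: lift_vec_def reduce_vec_def scalar_prod_def inner_sum_left atLeast0LessThan)

lemma reduce_vec_carrier [simp]: "reduce_vec B v \<in> carrier_vec (length B)"
  by (simp add: reduce_vec_def)

lemma reduce_lift_vec:
  assumes "orthonormal_columns B V" "u \<in> carrier_vec (length B)"
  shows "reduce_vec B (lift_vec B u) = u"
proof (rule eq_vecI)
  fix i assume "i < dim_vec u"
  then have i: "i < length B"
    using assms(2) by simp
  have "B ! i \<bullet> lift_vec B u = (\<Sum>j<length B. if j = i then u $ i else 0)"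
    unfolding lift_vec_def inner_sum_right
    using assms(1) i by (intro sum.cong) (auto simp: orthonormal_columns_def)
  then show "reduce_vec B (lift_vec B u) $ i = u $ i"
    using i by (simp add: reduce_vec_def)
qed (use assms(2) in \<open>simp add: reduce_vec_def\<close>)

lemma scalar_prod_lift_vec:
  assumes "orthonormal_columns B V" "w \<in> carrier_vec (length B)"
  shows "scalar_prod u w = lift_vec B u \<bullet> lift_vec B w"
  using assms by (simp add: lift_vec_inner reduce_lift_vec)

lemma norm_lift_reduce_vec_le:
  assumes "orthonormal_columns B V"
  shows "norm (lift_vec B (reduce_vec B v)) \<le> norm v"
proof -
  have "(norm (lift_vec B (reduce_vec B v)))\<^sup>2 = lift_vec B (reduce_vec B v) \<bullet> v"
    using assms by (simp add: power2_norm_eq_inner lift_vec_inner reduce_lift_vec)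
  also have "\<dots> \<le> norm (lift_vec B (reduce_vec B v)) * norm v"
    by (rule norm_cauchy_schwarz)
  finally show ?thesis
    by (cases "lift_vec B (reduce_vec B v) = 0") (simp_all add: power2_eq_square)
qed

lemma lift_vec_add:
  assumes "u \<in> carrier_vec (length B)" "w \<in> carrier_vec (length B)"
  shows "lift_vec B (u + w) = lift_vec B u + lift_vec B w"
  using assms by (simp add: lift_vec_def scaleR_left_distrib sum.distrib)

lemma lift_vec_diff:
  assumes "u \<in> carrier_vec (length B)" "w \<in> carrier_vec (length B)"
  shows "lift_vec B (u - w) = lift_vec B u - lift_vec B w"
  using assms by (simp add: lift_vec_def scaleR_left_diff_distrib sum_subtractf)

lemma lift_vec_smult:
  assumes "u \<in> carrier_vec (length B)"
  shows "lift_vec B (c \<cdot>\<^sub>v u) = c *\<^sub>R lift_vec B u"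
  using assms by (simp add: lift_vec_def scaleR_sum_right)

lemma smult_mult_mat_vec:
  fixes c :: real
  assumes "A \<in> carrier_mat nr nc" "v \<in> carrier_vec nc"
  shows "(c \<cdot>\<^sub>m A) *\<^sub>v v = c \<cdot>\<^sub>v (A *\<^sub>v v)"
  using assms by (intro eq_vecI) auto

lemma outer_mat_carrier [simp]:
  "u \<in> carrier_vec k \<Longrightarrow> v \<in> carrier_vec k \<Longrightarrow> outer_mat u v \<in> carrier_mat k k"
  by (simp add: outer_mat_def)

lemma outer_mat_mult_vec:
  assumes "u \<in> carrier_vec k" "v \<in> carrier_vec k" "w \<in> carrier_vec k"
  shows "outer_mat u v *\<^sub>v w = scalar_prod v w \<cdot>\<^sub>v u"
  using assms
  by (intro eq_vecI) (auto simp: outer_mat_def scalar_prod_def sum_distrib_left mult_ac intro!: sum.cong)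

text \<open>The update applied to a vector: \<open>u\<close> and \<open>z\<close> are the intermediate results of applying the right
  factor and then \<open>H\<close>.\<close>

lemma bfgs_update_mult_vec:
  assumes H: "H \<in> carrier_mat k k" and s: "s \<in> carrier_vec k" and y: "y \<in> carrier_vec k"
    and w: "w \<in> carrier_vec k" and \<rho>: "\<rho> = 1 / scalar_prod y s"
    and u: "u = w - (\<rho> * scalar_prod s w) \<cdot>\<^sub>v y" and z: "z = H *\<^sub>v u"
  shows "bfgs_update H (s, y) \<in> carrier_mat k k"
    and "bfgs_update H (s, y) *\<^sub>v w =
      (z - (\<rho> * scalar_prod y z) \<cdot>\<^sub>v s) + (\<rho> * scalar_prod s w) \<cdot>\<^sub>v s"
proof -
  have dim: "dim_vec s = k"
    using s by simp
  have factor: "(1\<^sub>m k - \<rho> \<cdot>\<^sub>m outer_mat p q) *\<^sub>v v = v - (\<rho> * scalar_prod q v) \<cdot>\<^sub>v p"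
    if "p \<in> carrier_vec k" "q \<in> carrier_vec k" "v \<in> carrier_vec k" for p q v
    using that
    by (simp add: minus_mult_distrib_mat_vec[of _ k k] smult_mult_mat_vec[of _ k k]
        outer_mat_mult_vec[of _ k] smult_smult_assoc)
  define R where "R = 1\<^sub>m k - \<rho> \<cdot>\<^sub>m outer_mat s y"
  define Q where "Q = 1\<^sub>m k - \<rho> \<cdot>\<^sub>m outer_mat y s"
  have carriers: "R \<in> carrier_mat k k" "Q \<in> carrier_mat k k" "u \<in> carrier_vec k" "z \<in> carrier_vec k"
    using H s y w unfolding R_def Q_def u z by (auto intro!: minus_carrier_mat)
  have update: "bfgs_update H (s, y) = R * H * Q + \<rho> \<cdot>\<^sub>m outer_mat s s"
    by (simp add: bfgs_update_def Let_def R_def Q_def dim \<rho>)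
  show "bfgs_update H (s, y) \<in> carrier_mat k k"
    unfolding update using H s carriers by simp
  have "bfgs_update H (s, y) *\<^sub>v w = R * H * Q *\<^sub>v w + (\<rho> \<cdot>\<^sub>m outer_mat s s) *\<^sub>v w"
    unfolding update using H s w carriers by (intro add_mult_distrib_mat_vec[of _ k k]) auto
  also have "R * H * Q *\<^sub>v w = R *\<^sub>v (H *\<^sub>v (Q *\<^sub>v w))"
    using H w carriers by (simp add: assoc_mult_mat_vec[of _ k k _ k])
  also have "Q *\<^sub>v w = u"
    unfolding Q_def u using s y w by (intro factor)
  also have "R *\<^sub>v (H *\<^sub>v u) = z - (\<rho> * scalar_prod y z) \<cdot>\<^sub>v s"
    unfolding R_def z[symmetric] using s y carriers by (intro factor)
  also have "(\<rho> \<cdot>\<^sub>m outer_mat s s) *\<^sub>v w = (\<rho> * scalar_prod s w) \<cdot>\<^sub>v s"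
    using s w by (simp add: smult_mult_mat_vec[of _ k k] outer_mat_mult_vec[of _ k] smult_smult_assoc)
  finally show "bfgs_update H (s, y) *\<^sub>v w =
      (z - (\<rho> * scalar_prod y z) \<cdot>\<^sub>v s) + (\<rho> * scalar_prod s w) \<cdot>\<^sub>v s" .
qed

text \<open>The heart of the uniform bounds, with \<open>w\<close> the argument of the updated operator, \<open>v\<close> its value, and
  \<open>z\<close> the value of the old operator at \<open>u\<close>. The hypotheses on the pair give
  \<open>\<rho> * (norm s)\<^sup>2 \<le> 1 / m\<close>, \<open>\<rho> * (norm y)\<^sup>2 \<le> L\<close> and \<open>\<rho> * norm s * norm y \<le> L / m\<close>. Therefore the
  outer factors have norm at most \<open>1 + L / m\<close>, which gives the upper bound. For the lower bound,
  \<open>w \<bullet> v = u \<bullet> z + \<rho> * (s \<bullet> w)\<^sup>2\<close>: where \<open>u\<close> is much smaller than \<open>w\<close>, the second term compensates. A pair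
  with \<open>y \<bullet> s = 0\<close> is covered, since then \<open>\<rho> = 0\<close>; it occurs when an iterate does not
  move.\<close>

lemma bfgs_operator_bounds:
  fixes s y w z :: "'a::real_inner"
  assumes "0 < m" "m \<le> L" and s: "m * (norm s)\<^sup>2 \<le> y \<bullet> s" and y: "(norm y)\<^sup>2 \<le> L * (y \<bullet> s)"
    and \<rho>: "\<rho> = 1 / (y \<bullet> s)" and u: "u = w - (\<rho> * (s \<bullet> w)) *\<^sub>R y"
    and "0 < a" "0 \<le> b" and lo: "a * (norm u)\<^sup>2 \<le> u \<bullet> z" and up: "norm z \<le> b * norm u"
    and v: "v = (z - (\<rho> * (y \<bullet> z)) *\<^sub>R s) + (\<rho> * (s \<bullet> w)) *\<^sub>R s"
  shows "min (a / 2) (1 / (2 * L)) * (norm w)\<^sup>2 \<le> w \<bullet> v"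
    and "norm v \<le> (b * (1 + L / m)\<^sup>2 + 1 / m) * norm w"
proof -
  have "0 < L"
    using assms by linarith
  have nonneg: "0 \<le> y \<bullet> s"
    using s \<open>0 < m\<close> zero_le_power2[of "norm s"] by (meson mult_nonneg_nonneg less_imp_le order_trans)
  then have "0 \<le> \<rho>"
    by (simp add: \<rho>)
  have \<rho>_le: "\<rho> * (y \<bullet> s) \<le> 1"
    by (simp add: \<rho>)
  have \<rho>s: "\<rho> * (norm s)\<^sup>2 \<le> 1 / m"
  proof -
    have "\<rho> * (m * (norm s)\<^sup>2) \<le> \<rho> * (y \<bullet> s)"
      using s \<open>0 \<le> \<rho>\<close> by (rule mult_left_mono)
    then have "\<rho> * (norm s)\<^sup>2 * m \<le> 1"
      using \<rho>_le by (simp add: mult_ac)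
    then show ?thesis
      using \<open>0 < m\<close> by (simp add: pos_le_divide_eq)
  qed
  have \<rho>y: "\<rho> * (norm y)\<^sup>2 \<le> L"
  proof -
    have "\<rho> * (norm y)\<^sup>2 \<le> \<rho> * (L * (y \<bullet> s))"
      using y \<open>0 \<le> \<rho>\<close> by (rule mult_left_mono)
    also have "\<dots> \<le> L * 1"
      using \<rho>_le \<open>0 < L\<close> mult_left_mono[OF \<rho>_le, of L] by (simp add: mult_ac)
    finally show ?thesis
      by simp
  qed
  have \<rho>sy: "\<rho> * norm s * norm y \<le> L / m"
  proof -
    have "(\<rho> * norm s * norm y)\<^sup>2 = (\<rho> * (norm s)\<^sup>2) * (\<rho> * (norm y)\<^sup>2)"
      by (simp add: power2_eq_square mult_ac)
    also have "\<dots> \<le> 1 / m * L"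
      using \<rho>s \<rho>y \<open>0 \<le> \<rho>\<close> \<open>0 < m\<close> by (intro mult_mono) auto
    also have "\<dots> \<le> (L / m)\<^sup>2"
      using \<open>0 < m\<close> \<open>m \<le> L\<close> by (simp add: power2_eq_square field_simps)
    finally show ?thesis
      by (rule power2_le_imp_le) (use \<open>0 < m\<close> \<open>0 < L\<close> in simp)
  qed
  have shear: "norm (p - (\<rho> * (q \<bullet> p)) *\<^sub>R r) \<le> (1 + L / m) * norm p"
    if "\<rho> * norm q * norm r \<le> L / m" for p q r :: 'a
  proof -
    have "norm ((\<rho> * (q \<bullet> p)) *\<^sub>R r) = \<rho> * \<bar>q \<bullet> p\<bar> * norm r"
      using \<open>0 \<le> \<rho>\<close> by (simp add: abs_mult)
    also have "\<dots> \<le> \<rho> * (norm q * norm p) * norm r"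
      using \<open>0 \<le> \<rho>\<close> by (intro mult_right_mono mult_left_mono Cauchy_Schwarz_ineq2) auto
    also have "\<dots> = (\<rho> * norm q * norm r) * norm p"
      by (simp add: mult_ac)
    also have "\<dots> \<le> L / m * norm p"
      using that by (rule mult_right_mono) simp
    finally show ?thesis
      using norm_triangle_ineq4[of p "(\<rho> * (q \<bullet> p)) *\<^sub>R r"] by (simp add: algebra_simps)
  qed

  have u_le: "norm u \<le> (1 + L / m) * norm w"
    unfolding u using \<rho>sy by (rule shear)
  have "norm (z - (\<rho> * (y \<bullet> z)) *\<^sub>R s) \<le> (1 + L / m) * norm z"
    using \<rho>sy by (intro shear) (simp add: mult_ac)
  also have "\<dots> \<le> (1 + L / m) * (b * ((1 + L / m) * norm w))"
    using up mult_left_mono[OF u_le \<open>0 \<le> b\<close>] \<open>0 < m\<close> \<open>0 < L\<close>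
    by (intro mult_left_mono) auto
  finally have main: "norm (z - (\<rho> * (y \<bullet> z)) *\<^sub>R s) \<le> b * (1 + L / m)\<^sup>2 * norm w"
    by (simp add: power2_eq_square mult_ac)
  have "norm ((\<rho> * (s \<bullet> w)) *\<^sub>R s) = \<rho> * \<bar>s \<bullet> w\<bar> * norm s"
    using \<open>0 \<le> \<rho>\<close> by (simp add: abs_mult)
  also have "\<dots> \<le> \<rho> * (norm s * norm w) * norm s"
    using \<open>0 \<le> \<rho>\<close> by (intro mult_right_mono mult_left_mono Cauchy_Schwarz_ineq2) auto
  also have "\<dots> = \<rho> * (norm s)\<^sup>2 * norm w"
    by (simp add: power2_eq_square mult_ac)
  also have "\<dots> \<le> 1 / m * norm w"
    using \<rho>s by (rule mult_right_mono) simp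
  finally have "norm ((\<rho> * (s \<bullet> w)) *\<^sub>R s) \<le> 1 / m * norm w" .
  with main show "norm v \<le> (b * (1 + L / m)\<^sup>2 + 1 / m) * norm w"
    unfolding v distrib_right by (rule norm_triangle_mono)

  define c where "c = s \<bullet> w"
  define k where "k = min (a / 2) (1 / (2 * L))"
  have "0 \<le> k"
    using \<open>0 < a\<close> \<open>0 < L\<close> by (simp add: k_def)
  have wv: "w \<bullet> v = u \<bullet> z + \<rho> * c\<^sup>2"
    by (simp add: u v c_def inner_diff_left inner_diff_right inner_add_right power2_eq_square
        inner_commute[of w] mult_ac)
  have "w = u + (\<rho> * c) *\<^sub>R y"
    by (simp add: u c_def)
  then have "norm w \<le> norm u + norm ((\<rho> * c) *\<^sub>R y)"
    using norm_triangle_ineq by metis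
  then have "(norm w)\<^sup>2 \<le> (norm u + norm ((\<rho> * c) *\<^sub>R y))\<^sup>2"
    by (intro power_mono) auto
  also have "\<dots> \<le> 2 * (norm u)\<^sup>2 + 2 * (norm ((\<rho> * c) *\<^sub>R y))\<^sup>2"
    using sum_squares_bound[of "norm u" "norm ((\<rho> * c) *\<^sub>R y)"] by (simp add: power2_sum)
  also have "(norm ((\<rho> * c) *\<^sub>R y))\<^sup>2 = (\<rho> * c\<^sup>2) * (\<rho> * (norm y)\<^sup>2)"
    by (simp add: power_mult_distrib power2_eq_square mult_ac)
  also have "\<dots> \<le> (\<rho> * c\<^sup>2) * L"
    using \<rho>y \<open>0 \<le> \<rho>\<close> by (intro mult_left_mono) auto
  finally have "k * (norm w)\<^sup>2 \<le> k * (2 * (norm u)\<^sup>2 + 2 * ((\<rho> * c\<^sup>2) * L))"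
    using \<open>0 \<le> k\<close> by (simp add: mult_left_mono)
  also have "\<dots> = (2 * k) * (norm u)\<^sup>2 + (2 * L * k) * (\<rho> * c\<^sup>2)"
    by (simp add: algebra_simps)
  also have "\<dots> \<le> a * (norm u)\<^sup>2 + 1 * (\<rho> * c\<^sup>2)"
  proof (intro add_mono mult_right_mono)
    show "2 * k \<le> a"
      by (simp add: k_def)
    have "k \<le> 1 / (2 * L)"
      by (simp add: k_def)
    then show "2 * L * k \<le> 1"
      using \<open>0 < L\<close> by (simp add: field_simps)
  qed (use \<open>0 \<le> \<rho>\<close> in auto)
  also have "\<dots> \<le> w \<bullet> v"
    using lo wv by simp
  finally show "min (a / 2) (1 / (2 * L)) * (norm w)\<^sup>2 \<le> w \<bullet> v"
    by (simp add: k_def)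
qed

text \<open>Reduced vectors are measured through \<^const>\<open>lift_vec\<close>, an isometry for orthonormal \<open>B\<close>, so that
  the estimates can use the norm and the Cauchy-Schwarz inequality of the ambient space.\<close>

definition model_bounds :: "(real ^ 'n) list \<Rightarrow> real \<Rightarrow> real \<Rightarrow> real Matrix.mat \<Rightarrow> bool" where
  "model_bounds B a b H \<longleftrightarrow> H \<in> carrier_mat (length B) (length B) \<and>
     (\<forall>w \<in> carrier_vec (length B).
        a * (norm (lift_vec B w))\<^sup>2 \<le> lift_vec B w \<bullet> lift_vec B (H *\<^sub>v w) \<and>
        norm (lift_vec B (H *\<^sub>v w)) \<le> b * norm (lift_vec B w))"

text \<open>The strong monotonicity and cocoercivity of a gradient, seen by a single reduced pair.\<close>

definition curvature_pair ::
    "(real ^ 'n) list \<Rightarrow> real \<Rightarrow> real \<Rightarrow> real Matrix.vec \<times> real Matrix.vec \<Rightarrow> bool" where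
  "curvature_pair B m L = (\<lambda>(s, y).
     s \<in> carrier_vec (length B) \<and> y \<in> carrier_vec (length B) \<and>
     m * (norm (lift_vec B s))\<^sup>2 \<le> lift_vec B y \<bullet> lift_vec B s \<and>
     (norm (lift_vec B y))\<^sup>2 \<le> L * (lift_vec B y \<bullet> lift_vec B s))"

lemma model_bounds_bfgs_update:
  assumes B: "orthonormal_columns B V" and "0 < m" "m \<le> L" "0 < a" "0 \<le> b"
    and H: "model_bounds B a b H" and pair: "curvature_pair B m L pr"
  shows "model_bounds B (min (a / 2) (1 / (2 * L))) (b * (1 + L / m)\<^sup>2 + 1 / m) (bfgs_update H pr)"
proof -
  obtain s y where pr: "pr = (s, y)"
    by fastforce
  have s: "s \<in> carrier_vec (length B)" and y: "y \<in> carrier_vec (length B)"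
    and ms: "m * (norm (lift_vec B s))\<^sup>2 \<le> lift_vec B y \<bullet> lift_vec B s"
    and Ly: "(norm (lift_vec B y))\<^sup>2 \<le> L * (lift_vec B y \<bullet> lift_vec B s)"
    using pair by (auto simp: pr curvature_pair_def)
  have Hc: "H \<in> carrier_mat (length B) (length B)"
    using H by (simp add: model_bounds_def)
  show ?thesis
    unfolding model_bounds_def
  proof (intro conjI ballI)
    show "bfgs_update H pr \<in> carrier_mat (length B) (length B)"
      unfolding pr using bfgs_update_mult_vec(1)[OF Hc s y zero_carrier_vec refl refl refl] .
    fix w :: "real Matrix.vec" assume w: "w \<in> carrier_vec (length B)"
    define \<rho> where "\<rho> = 1 / scalar_prod y s"
    define u where "u = w - (\<rho> * scalar_prod s w) \<cdot>\<^sub>v y"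
    define z where "z = H *\<^sub>v u"
    have uz: "u \<in> carrier_vec (length B)" "z \<in> carrier_vec (length B)"
      using w y Hc by (auto simp: u_def z_def)
    have \<rho>: "\<rho> = 1 / (lift_vec B y \<bullet> lift_vec B s)"
      by (simp add: \<rho>_def scalar_prod_lift_vec[OF B s])
    have u: "lift_vec B u = lift_vec B w - (\<rho> * (lift_vec B s \<bullet> lift_vec B w)) *\<^sub>R lift_vec B y"
      using w y by (simp add: u_def lift_vec_diff lift_vec_smult scalar_prod_lift_vec[OF B w])
    have v: "lift_vec B (bfgs_update H pr *\<^sub>v w) =
        (lift_vec B z - (\<rho> * (lift_vec B y \<bullet> lift_vec B z)) *\<^sub>R lift_vec B s) +
        (\<rho> * (lift_vec B s \<bullet> lift_vec B w)) *\<^sub>R lift_vec B s"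
      unfolding pr bfgs_update_mult_vec(2)[OF Hc s y w \<rho>_def u_def z_def]
      using s uz by (simp add: lift_vec_add lift_vec_diff lift_vec_smult
          scalar_prod_lift_vec[OF B w] scalar_prod_lift_vec[OF B uz(2)])
    have lo: "a * (norm (lift_vec B u))\<^sup>2 \<le> lift_vec B u \<bullet> lift_vec B z"
      and up: "norm (lift_vec B z) \<le> b * norm (lift_vec B u)"
      using H uz(1) by (auto simp: model_bounds_def z_def)
    note bounds = bfgs_operator_bounds[OF \<open>0 < m\<close> \<open>m \<le> L\<close> ms Ly \<rho> u \<open>0 < a\<close> \<open>0 \<le> b\<close> lo up v]
    show "min (a / 2) (1 / (2 * L)) * (norm (lift_vec B w))\<^sup>2
        \<le> lift_vec B w \<bullet> lift_vec B (bfgs_update H pr *\<^sub>v w)"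
      by (rule bounds(1))
    show "norm (lift_vec B (bfgs_update H pr *\<^sub>v w))
        \<le> (b * (1 + L / m)\<^sup>2 + 1 / m) * norm (lift_vec B w)"
      by (rule bounds(2))
  qed
qed

lemma model_bounds_mono:
  assumes "model_bounds B a b H" "a' \<le> a" "b \<le> b'"
  shows "model_bounds B a' b' H"
  using assms unfolding model_bounds_def
  by (meson mult_right_mono norm_ge_zero order_trans zero_le_power2)

text \<open>The constants are chosen before \<open>B\<close> and \<open>ps\<close>: they depend only on the number of updates, not on
  the face or its dimension.\<close>

lemma bfgs_iterates_uniform_bounds:
  assumes "0 < m" "m \<le> L" "0 < \<mu>"
  shows "\<exists>a>0. \<exists>b>0. \<forall>(B :: (real ^ 'n) list) V ps.
    orthonormal_columns B V \<longrightarrow> length ps \<le> N \<longrightarrow> (\<forall>pr \<in> set ps. curvature_pair B m L pr) \<longrightarrow>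
    model_bounds B a b (foldl bfgs_update (\<mu> \<cdot>\<^sub>m 1\<^sub>m (length B)) ps)"
proof (induction N)
  case 0
  have "model_bounds B \<mu> \<mu> (\<mu> \<cdot>\<^sub>m 1\<^sub>m (length B))" for B :: "(real ^ 'n) list"
    using \<open>0 < \<mu>\<close>
    by (auto simp: model_bounds_def smult_mult_mat_vec[of _ "length B" "length B"] lift_vec_smult
        power2_norm_eq_inner)
  with \<open>0 < \<mu>\<close> show ?case
    by auto
next
  case (Suc N)
  then obtain a b where "0 < a" "0 < b" and ab: "\<And>(B :: (real ^ 'n) list) V ps.
      orthonormal_columns B V \<Longrightarrow> length ps \<le> N \<Longrightarrow> (\<And>pr. pr \<in> set ps \<Longrightarrow> curvature_pair B m L pr) \<Longrightarrow>
      model_bounds B a b (foldl bfgs_update (\<mu> \<cdot>\<^sub>m 1\<^sub>m (length B)) ps)"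
    by blast
  define a' where "a' = min (a / 2) (1 / (2 * L))"
  define b' where "b' = b * (1 + L / m)\<^sup>2 + 1 / m"
  have "0 < L"
    using assms by linarith
  have "0 < a'" "a' \<le> a"
    using \<open>0 < a\<close> \<open>0 < L\<close> by (auto simp: a'_def)
  have "b * 1 \<le> b * (1 + L / m)\<^sup>2"
    using \<open>0 < b\<close> \<open>0 < m\<close> \<open>0 < L\<close> by (intro mult_left_mono one_le_power) auto
  then have "b \<le> b'"
    using \<open>0 < m\<close> by (simp add: b'_def add_increasing2)
  have "model_bounds B a' b' (foldl bfgs_update (\<mu> \<cdot>\<^sub>m 1\<^sub>m (length B)) ps)"
    if B: "orthonormal_columns B V" and len: "length ps \<le> Suc N"
      and pairs: "\<forall>pr \<in> set ps. curvature_pair B m L pr"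
    for B :: "(real ^ 'n) list" and V ps
  proof (cases ps rule: rev_cases)
    case Nil
    then show ?thesis
      using model_bounds_mono[OF ab[OF B, of "[]"] \<open>a' \<le> a\<close> \<open>b \<le> b'\<close>] by simp
  next
    case (snoc qs q)
    have "model_bounds B a b (foldl bfgs_update (\<mu> \<cdot>\<^sub>m 1\<^sub>m (length B)) qs)"
      using len pairs by (intro ab[OF B]) (auto simp: snoc)
    then show ?thesis
      using model_bounds_bfgs_update[OF B \<open>0 < m\<close> \<open>m \<le> L\<close> \<open>0 < a\<close> less_imp_le[OF \<open>0 < b\<close>]] pairs
      by (simp add: snoc a'_def b'_def)
  qed
  then show ?case
    using \<open>0 < a'\<close> \<open>b \<le> b'\<close> \<open>0 < b\<close> by (metis less_le_trans)
qed

lemma lbfgs_mat_uniform_bounds: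
  assumes "0 < m" "m \<le> L" "0 < \<mu>"
  obtains a b where "0 < a" "0 < b"
    "\<And>(B :: (real ^ 'n) list) V ps. orthonormal_columns B V \<Longrightarrow>
       (\<And>pr. pr \<in> set ps \<Longrightarrow> curvature_pair B m L pr) \<Longrightarrow>
       model_bounds B a b (lbfgs_mat N \<mu> (length B) ps)"
proof -
  obtain a b where "0 < a" "0 < b" and ab: "\<forall>(B :: (real ^ 'n) list) V ps.
      orthonormal_columns B V \<longrightarrow> length ps \<le> N \<longrightarrow> (\<forall>pr \<in> set ps. curvature_pair B m L pr) \<longrightarrow>
      model_bounds B a b (foldl bfgs_update (\<mu> \<cdot>\<^sub>m 1\<^sub>m (length B)) ps)"
    using bfgs_iterates_uniform_bounds[OF assms] by blast
  have "model_bounds B a b (lbfgs_mat N \<mu> (length B) ps)"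
    if "orthonormal_columns B V" "\<And>pr. pr \<in> set ps \<Longrightarrow> curvature_pair B m L pr"
    for B :: "(real ^ 'n) list" and V ps
  proof -
    have "length (drop (length ps - N) ps) \<le> N"
      by simp
    moreover have "\<forall>pr \<in> set (drop (length ps - N) ps). curvature_pair B m L pr"
      using that(2) set_drop_subset by fast
    ultimately show ?thesis
      using ab that(1) unfolding lbfgs_mat_def by blast
  qed
  with \<open>0 < a\<close> \<open>0 < b\<close> show thesis
    using that by blast
qed

section \<open>Contraction by the steps of the hybrid algorithm\<close>

lemma spectral_step_bounds:
  assumes "valid_params p"
  shows "alpha_min p \<le> spectral_step p g x t" "spectral_step p g x t \<le> alpha_max p"
  using assms by (auto simp: valid_params_def spectral_step_def Let_def)

lemma hist_max_bounds:
  assumes "valid_params p" "r \<le> t"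
  shows "f (x t) \<le> hist_max p f x r t"
    and "\<exists>j\<le>t. t < j + hist_len p \<and> hist_max p f x r t = f (x j)"
proof -
  define V where "V = {f (x j) | j. r \<le> j \<and> j \<le> t \<and> t < j + hist_len p}"
  have "V \<subseteq> (\<lambda>j. f (x j)) ` {..t}"
    by (auto simp: V_def)
  then have "finite V"
    using finite_surj by blast
  moreover have mem: "f (x t) \<in> V"
    using assms by (auto simp: V_def valid_params_def)
  ultimately show "f (x t) \<le> hist_max p f x r t"
    by (simp add: hist_max_def V_def)
  have "Max V \<in> V"
    using \<open>finite V\<close> mem by (intro Max_in) auto
  then show "\<exists>j\<le>t. t < j + hist_len p \<and> hist_max p f x r t = f (x j)"
    by (auto simp: hist_max_def V_def)
qed

text \<open>Since the history maximum is at least \<open>f (x t)\<close>, every trial step of length at most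
  \<open>2 * (1 - gamma p) / L\<close> is accepted; the accepted length is either the first trial or within one
  factor \<open>eta p\<close> of this threshold.\<close>

lemma pg_next_accepted_step:
  fixes C :: "(real ^ 'n) set"
  assumes "smooth_strongly_convex f g m L" and p: "valid_params p"
    and C: "closed C" "convex C" and x: "x t \<in> C" and hist: "f (x t) \<le> hist_max p f x r t"
  defines "x' \<equiv> pg_next p C f g x r t"
  obtains a where "min (alpha_min p) (eta p * (2 * (1 - gamma p) / L)) \<le> a" "a \<le> alpha_max p"
    "x' = closest_point C (x t - a *\<^sub>R g (x t))"
    "f x' \<le> hist_max p f x r t + gamma p * (g (x t) \<bullet> (x' - x t))"
proof -
  interpret smooth_strongly_convex f g m L by fact
  define c where "c = 2 * (1 - gamma p) / L"
  define \<alpha> where "\<alpha> = spectral_step p g x t"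
  define P where "P k \<longleftrightarrow> f (pg_point C g (x t) (eta p ^ k * \<alpha>)) \<le> hist_max p f x r t +
    gamma p * (g (x t) \<bullet> (pg_point C g (x t) (eta p ^ k * \<alpha>) - x t))" for k
  have \<eta>: "0 < eta p" "eta p < 1" and \<gamma>: "gamma p < 1"
    using p by (auto simp: valid_params_def)
  have \<alpha>: "alpha_min p \<le> \<alpha>" "\<alpha> \<le> alpha_max p" "0 < \<alpha>"
    using spectral_step_bounds[OF p, of g x t] p by (auto simp: \<alpha>_def valid_params_def)
  have "0 < c"
    using \<gamma> L_pos by (simp add: c_def)
  have short: "P k" if "eta p ^ k * \<alpha> \<le> c" for k
    using projected_step_sufficient_decrease[OF C x _ refl \<gamma> that[unfolded c_def]] \<eta> \<alpha> hist
    by (simp add: P_def pg_point_def)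
  obtain k where "eta p ^ k < c / \<alpha>"
    using real_arch_pow_inv[of "c / \<alpha>" "eta p"] \<eta> \<open>0 < c\<close> \<alpha> by auto
  then have "P k"
    using \<alpha> by (intro short) (simp add: field_simps)
  define K where "K = (LEAST k. P k)"
  have "P K"
    unfolding K_def using \<open>P k\<close> by (rule LeastI)
  define a where "a = eta p ^ K * \<alpha>"
  have x': "x' = pg_point C g (x t) a"
    by (simp add: x'_def pg_next_def Let_def a_def K_def P_def \<alpha>_def)
  show thesis
  proof
    show "min (alpha_min p) (eta p * (2 * (1 - gamma p) / L)) \<le> a"
    proof (cases K)
      case 0
      then show ?thesis
        using \<alpha> by (simp add: a_def)
    next
      case (Suc i)
      then have "\<not> P i"
        using not_less_Least[of i P] by (simp add: K_def)
      then have "c \<le> eta p ^ i * \<alpha>"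
        using short[of i] by linarith
      then have "eta p * c \<le> eta p * (eta p ^ i * \<alpha>)"
        using \<eta> by (intro mult_left_mono) auto
      then show ?thesis
        by (simp add: a_def Suc c_def)
    qed
    have "eta p ^ K * \<alpha> \<le> 1 * \<alpha>"
      using \<eta> \<alpha> by (intro mult_right_mono power_le_one) auto
    then show "a \<le> alpha_max p"
      using \<alpha> unfolding a_def by linarith
    show "x' = closest_point C (x t - a *\<^sub>R g (x t))"
      by (simp add: x' pg_point_def)
    show "f x' \<le> hist_max p f x r t + gamma p * (g (x t) \<bullet> (x' - x t))"
      using \<open>P K\<close> by (simp add: P_def x' a_def)
  qed
qed

text \<open>With \<open>\<delta> = (norm (x' - x))\<^sup>2\<close> and \<open>h\<close> the history maximum, the gap \<open>e\<close> at the new point satisfies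
  both \<open>e \<le> K * \<delta>\<close> and \<open>e \<le> (h - f z) - \<kappa> * \<delta>\<close>. The combination that eliminates \<open>\<delta>\<close> gives the factor
  \<open>K / (K + \<kappa>)\<close>.\<close>

lemma pg_next_contraction:
  fixes C :: "(real ^ 'n) set"
  assumes "smooth_strongly_convex f g m L" and p: "valid_params p"
    and C: "closed C" "convex C" and z: "z \<in> C" and min: "\<And>y. y \<in> C \<Longrightarrow> f z \<le> f y"
  obtains q where "0 \<le> q" "q < 1"
    "\<And>x r t. x t \<in> C \<Longrightarrow> f (x t) \<le> hist_max p f x r t \<Longrightarrow>
       f (pg_next p C f g x r t) - f z \<le> q * (hist_max p f x r t - f z)"
proof -
  interpret smooth_strongly_convex f g m L by fact
  define a\<^sub>0 where "a\<^sub>0 = min (alpha_min p) (eta p * (2 * (1 - gamma p) / L))"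
  define K where "K = 4 / m * (L + 1 / a\<^sub>0)\<^sup>2"
  define \<kappa> where "\<kappa> = gamma p / alpha_max p"
  have p_pos: "0 < alpha_min p" "0 < alpha_max p" "0 < gamma p" "gamma p < 1" "0 < eta p"
    using p by (auto simp: valid_params_def)
  have "0 < a\<^sub>0"
    using p_pos L_pos by (simp add: a\<^sub>0_def)
  have "L + 1 / a\<^sub>0 > 0"
    using L_pos \<open>0 < a\<^sub>0\<close> by (simp add: add_pos_pos)
  then have "0 < K"
    using m_pos by (simp add: K_def)
  have "0 < \<kappa>"
    using p_pos by (simp add: \<kappa>_def)
  have "f (pg_next p C f g x r t) - f z \<le> K / (K + \<kappa>) * (hist_max p f x r t - f z)"
    if x: "x t \<in> C" and hist: "f (x t) \<le> hist_max p f x r t" for x r t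
  proof -
    define x' where "x' = pg_next p C f g x r t"
    define h where "h = hist_max p f x r t"
    define \<delta> where "\<delta> = (norm (x' - x t))\<^sup>2"
    obtain a where a: "a\<^sub>0 \<le> a" "a \<le> alpha_max p" and x': "x' = closest_point C (x t - a *\<^sub>R g (x t))"
      and accept: "f x' \<le> h + gamma p * (g (x t) \<bullet> (x' - x t))"
      using pg_next_accepted_step[OF assms(1) p C x hist] unfolding x'_def h_def a\<^sub>0_def by metis
    have "0 < a"
      using a \<open>0 < a\<^sub>0\<close> by linarith
    have "f x' - f z \<le> 4 / m * (L + 1 / a)\<^sup>2 * \<delta>"
      unfolding \<delta>_def using projected_step_gap[OF C x \<open>0 < a\<close> x' z min] by simp
    also have "\<dots> \<le> K * \<delta>"
      unfolding K_def
      using a \<open>0 < a\<close> \<open>0 < a\<^sub>0\<close> m_pos L_pos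
      by (intro mult_right_mono mult_left_mono power_mono add_left_mono divide_left_mono)
        (auto simp: \<delta>_def)
    finally have gap: "f x' - f z \<le> K * \<delta>" .
    have "g (x t) \<bullet> (x' - x t) \<le> - \<delta> / a"
      unfolding \<delta>_def using projected_step_slope[OF C x \<open>0 < a\<close> x'] .
    also have "\<dots> \<le> - \<delta> / alpha_max p"
      using a \<open>0 < a\<close> p_pos by (auto simp: \<delta>_def intro!: divide_left_mono)
    finally have "gamma p * (g (x t) \<bullet> (x' - x t)) \<le> gamma p * (- \<delta> / alpha_max p)"
      using p_pos by (intro mult_left_mono) auto
    then have "f x' - f z \<le> (h - f z) - \<kappa> * \<delta>"
      using accept by (simp add: \<kappa>_def)
    then have "K * (f x' - f z) \<le> K * ((h - f z) - \<kappa> * \<delta>)"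
      using \<open>0 < K\<close> by (intro mult_left_mono) auto
    moreover have "\<kappa> * (f x' - f z) \<le> \<kappa> * (K * \<delta>)"
      using gap \<open>0 < \<kappa>\<close> by (intro mult_left_mono) auto
    ultimately have "(K + \<kappa>) * (f x' - f z) \<le> K * (h - f z)"
      by (simp add: algebra_simps)
    then show ?thesis
      using \<open>0 < K\<close> \<open>0 < \<kappa>\<close> by (simp add: x'_def h_def pos_le_divide_eq mult.commute)
  qed
  moreover have "0 \<le> K / (K + \<kappa>)" "K / (K + \<kappa>) < 1"
    using \<open>0 < K\<close> \<open>0 < \<kappa>\<close> by auto
  ultimately show thesis
    using that by blast
qed

text \<open>The curvature condition forces the slope along \<open>d\<close> to change by at least
  \<open>(1 - c2) * \<bar>g x \<bullet> d\<bar>\<close>, which bounds \<open>\<theta>\<close> from below because the gradient is Lipschitz; the decrease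
  then comes from the Armijo condition. In the application \<open>h\<close> is the norm of the projected
  gradient.\<close>

lemma (in smooth_strongly_convex) wolfe_decrease:
  assumes "0 < \<theta>" "0 < c1" "c2 < 1" "0 < a" "0 < b" "0 \<le> h"
    and slope: "g x \<bullet> d \<le> - a * h\<^sup>2" and len: "norm d \<le> b * h"
    and armijo: "f (x + \<theta> *\<^sub>R d) \<le> f x + c1 * \<theta> * (g x \<bullet> d)"
    and curvature: "c2 * (g x \<bullet> d) \<le> g (x + \<theta> *\<^sub>R d) \<bullet> d"
  shows "f (x + \<theta> *\<^sub>R d) \<le> f x - c1 * (1 - c2) * a\<^sup>2 / (L * b\<^sup>2) * h\<^sup>2"
proof -
  have "(1 - c2) * a / (L * b\<^sup>2) * (a * h\<^sup>2) \<le> \<theta> * (a * h\<^sup>2)"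
  proof (cases "h = 0")
    case False
    have "\<theta> * ((g (x + \<theta> *\<^sub>R d) - g x) \<bullet> d) \<le> \<theta> * (L * \<theta> * (norm d)\<^sup>2)"
      using gradient_difference_le[of "x + \<theta> *\<^sub>R d" x]
      by (simp add: power_mult_distrib power2_eq_square mult_ac)
    then have "(g (x + \<theta> *\<^sub>R d) - g x) \<bullet> d \<le> L * \<theta> * (norm d)\<^sup>2"
      using \<open>0 < \<theta>\<close> by simp
    also have "\<dots> \<le> L * \<theta> * (b * h)\<^sup>2"
      using len L_pos \<open>0 < \<theta>\<close> by (intro mult_left_mono power_mono) auto
    finally have "(1 - c2) * - (g x \<bullet> d) \<le> L * \<theta> * (b * h)\<^sup>2"
      using curvature by (simp add: inner_diff_left algebra_simps)
    moreover have "(1 - c2) * (a * h\<^sup>2) \<le> (1 - c2) * - (g x \<bullet> d)"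
      using slope \<open>c2 < 1\<close> by (intro mult_left_mono) auto
    ultimately have "((1 - c2) * a) * h\<^sup>2 \<le> (\<theta> * (L * b\<^sup>2)) * h\<^sup>2"
      by (simp add: power_mult_distrib mult_ac)
    then have "(1 - c2) * a \<le> \<theta> * (L * b\<^sup>2)"
      using False by (simp add: mult_le_cancel_right)
    then have "(1 - c2) * a / (L * b\<^sup>2) \<le> \<theta>"
      using L_pos \<open>0 < b\<close> by (simp add: pos_divide_le_eq)
    then show ?thesis
      using \<open>0 < a\<close> by (intro mult_right_mono) auto
  qed simp
  also have "\<dots> \<le> \<theta> * - (g x \<bullet> d)"
    using slope \<open>0 < \<theta>\<close> by (intro mult_left_mono) auto
  finally have "c1 * ((1 - c2) * a / (L * b\<^sup>2) * (a * h\<^sup>2)) \<le> c1 * (\<theta> * - (g x \<bullet> d))"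
    using \<open>0 < c1\<close> by (intro mult_left_mono) auto
  then show ?thesis
    using armijo by (simp add: power2_eq_square mult_ac)
qed

lemma qn_direction_bounds:
  assumes B: "orthonormal_columns B V" and H: "model_bounds B a b H"
  shows "v \<bullet> qn_direction B H v \<le> - a * (norm (lift_vec B (reduce_vec B v)))\<^sup>2"
    and "norm (qn_direction B H v) \<le> b * norm (lift_vec B (reduce_vec B v))"
proof -
  have "H *\<^sub>v reduce_vec B v \<in> carrier_vec (length B)"
    using H by (auto simp: model_bounds_def)
  then have "lift_vec B (reduce_vec B v) \<bullet> lift_vec B (H *\<^sub>v reduce_vec B v) =
      scalar_prod (reduce_vec B v) (H *\<^sub>v reduce_vec B v)"
    using scalar_prod_lift_vec[OF B] by simp
  also have "\<dots> = scalar_prod (H *\<^sub>v reduce_vec B v) (reduce_vec B v)"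
    using \<open>H *\<^sub>v reduce_vec B v \<in> carrier_vec (length B)\<close>
    by (intro comm_scalar_prod[of _ "length B"]) auto
  also have "\<dots> = v \<bullet> lift_vec B (H *\<^sub>v reduce_vec B v)"
    by (simp add: lift_vec_inner[symmetric] inner_commute)
  finally have slope: "v \<bullet> lift_vec B (H *\<^sub>v reduce_vec B v) =
      lift_vec B (reduce_vec B v) \<bullet> lift_vec B (H *\<^sub>v reduce_vec B v)"
    by simp
  have "a * (norm (lift_vec B (reduce_vec B v)))\<^sup>2 \<le>
      lift_vec B (reduce_vec B v) \<bullet> lift_vec B (H *\<^sub>v reduce_vec B v)"
    and "norm (lift_vec B (H *\<^sub>v reduce_vec B v)) \<le> b * norm (lift_vec B (reduce_vec B v))"
    using H reduce_vec_carrier[of B v] unfolding model_bounds_def by blast+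
  then show "v \<bullet> qn_direction B H v \<le> - a * (norm (lift_vec B (reduce_vec B v)))\<^sup>2"
    and "norm (qn_direction B H v) \<le> b * norm (lift_vec B (reduce_vec B v))"
    by (simp_all add: qn_direction_def slope)
qed

lemma qn_step_contraction:
  fixes C :: "(real ^ 'n) set"
  assumes "smooth_strongly_convex f g m L" and p: "valid_params p" and C: "polyhedron C"
    and z: "z \<in> C" and min: "\<And>y. y \<in> C \<Longrightarrow> f z \<le> f y" and "0 < a" "0 < b"
  obtains q where "0 \<le> q" "q < 1"
    "\<And>x x' B H. x \<in> C \<Longrightarrow> - g x \<in> self_proj C (face_at C x) \<Longrightarrow>
       orthonormal_columns B (diff_hull (face_at C x)) \<Longrightarrow> model_bounds B a b H \<Longrightarrow>
       qn_step p C f g x (qn_direction B H (g x)) x' \<Longrightarrow> f x' - f z \<le> q * (f x - f z)"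
proof -
  interpret smooth_strongly_convex f g m L by fact
  have cC: "closed C" "convex C"
    using C polyhedron_imp_closed polyhedron_imp_convex by auto
  define c where "c = gamma_1 p * (1 - gamma_2 p) * a\<^sup>2 / (L * b\<^sup>2)"
  have "0 < c"
    using p \<open>0 < a\<close> \<open>0 < b\<close> L_pos by (simp add: c_def valid_params_def)
  have "f x' - f z \<le> max 0 (1 - c * (m / 4)) * (f x - f z)"
    if x: "x \<in> C" and sp: "- g x \<in> self_proj C (face_at C x)"
      and B: "orthonormal_columns B (diff_hull (face_at C x))" and H: "model_bounds B a b H"
      and step: "qn_step p C f g x (qn_direction B H (g x)) x'" for x x' B H
  proof -
    define d where "d = qn_direction B H (g x)"
    define h where "h = norm (lift_vec B (reduce_vec B (g x)))"
    obtain \<theta> where "0 < \<theta>" and x': "x' = x + \<theta> *\<^sub>R d"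
      and armijo: "f (x + \<theta> *\<^sub>R d) \<le> f x + gamma_1 p * \<theta> * (g x \<bullet> d)"
      and curvature: "gamma_2 p * (g x \<bullet> d) \<le> g (x + \<theta> *\<^sub>R d) \<bullet> d"
      using step by (auto simp: qn_step_def d_def)
    have "f x' \<le> f x - c * h\<^sup>2"
      unfolding x' c_def
      using p \<open>0 < a\<close> \<open>0 < b\<close> \<open>0 < \<theta>\<close> armijo curvature qn_direction_bounds[OF B H, of "g x"]
      by (intro wolfe_decrease) (auto simp: valid_params_def d_def h_def)
    moreover have "f x - f z \<le> h * norm (x - z)"
      using gradient_inequality[of x z] self_proj_slope_le[OF cC face_at_polyhedron[OF C x] sp B z]
      by (simp add: inner_diff_right h_def)
    then have "f x - f z \<le> 4 / m * h\<^sup>2"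
      using cC x z min by (intro gap_le_of_linear_bound) (auto simp: h_def)
    then have "c * (m / 4 * (f x - f z)) \<le> c * h\<^sup>2"
      using \<open>0 < c\<close> m_pos by (intro mult_left_mono) (auto simp: field_simps)
    moreover have "(1 - c * (m / 4)) * (f x - f z) = (f x - f z) - c * (m / 4 * (f x - f z))"
      by (simp add: left_diff_distrib mult.assoc)
    ultimately have "f x' - f z \<le> (1 - c * (m / 4)) * (f x - f z)"
      by linarith
    also have "\<dots> \<le> max 0 (1 - c * (m / 4)) * (f x - f z)"
      using min[OF x] by (intro mult_right_mono) auto
    finally show ?thesis .
  qed
  moreover have "max 0 (1 - c * (m / 4)) < 1"
    using \<open>0 < c\<close> m_pos by simp
  ultimately show thesis
    using that[of "max 0 (1 - c * (m / 4))"] by simp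
qed

text \<open>The lifted gradient difference is its projection onto \<open>V\<close>. As \<open>u - v\<close> lies in \<open>V\<close>, projecting
  preserves the inner product with it, and it can only shorten the gradient difference.\<close>

lemma curvature_pair_of_gradients:
  fixes g :: "real ^ 'n \<Rightarrow> real ^ 'n"
  assumes "smooth_strongly_convex f g m L" and B: "orthonormal_columns B V" and "u - v \<in> V"
  shows "curvature_pair B m L (reduce_vec B (u - v), reduce_vec B (g u - g v))"
proof -
  interpret smooth_strongly_convex f g m L by fact
  have s: "lift_vec B (reduce_vec B (u - v)) = u - v"
    using B \<open>u - v \<in> V\<close> by (rule lift_reduce_vec_in_span)
  have "lift_vec B (reduce_vec B (g u - g v)) \<bullet> (u - v) =
      (g u - g v) \<bullet> lift_vec B (reduce_vec B (u - v))"
    by (simp add: lift_reduce_vec inner_sum_left inner_sum_right inner_commute mult.commute)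
  then have ys: "lift_vec B (reduce_vec B (g u - g v)) \<bullet> (u - v) = (g u - g v) \<bullet> (u - v)"
    by (simp add: s)
  have "(norm (lift_vec B (reduce_vec B (g u - g v))))\<^sup>2 \<le> (norm (g u - g v))\<^sup>2"
    using norm_lift_reduce_vec_le[OF B] by (intro power_mono) auto
  also have "\<dots> \<le> L * ((g u - g v) \<bullet> (u - v))"
    by (rule cocoercive)
  finally show ?thesis
    using strongly_monotone[of u v] by (simp add: curvature_pair_def s ys)
qed

text \<open>A model survives only while the iterates stay on one face, so all its pairs come from consecutive
  iterates on the current face and refer to one orthonormal basis of its directions.\<close>

lemma model_update_invariant:
  fixes C :: "(real ^ 'n) set"
  assumes ssc: "smooth_strongly_convex f g m L" and C: "polyhedron C"
    and \<Phi>: "\<And>F. F face_of C \<Longrightarrow> F \<noteq> {} \<Longrightarrow> orthonormal_columns (\<Phi> F) (diff_hull F)"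
    and x: "\<And>t. x t \<in> C" and "H 0 = None" and update: "\<And>t. model_update p C g \<Phi> x H B S t"
    and Ht: "H t = Some Ht"
  shows "orthonormal_columns (B t) (diff_hull (face_at C (x t)))
    \<and> - g (x t) \<in> self_proj C (face_at C (x t))
    \<and> (\<forall>pr \<in> set (S t). curvature_pair (B t) m L pr)
    \<and> Ht = lbfgs_mat (memory p) (mu p) (length (B t)) (S t)"
  using Ht
proof (induction t arbitrary: Ht)
  case 0
  then show ?case
    using \<open>H 0 = None\<close> by simp
next
  case (Suc t)
  define F where "F = face_at C (x (Suc t))"
  have F: "F face_of C" "x (Suc t) \<in> rel_interior F"
    using face_at_polyhedron[OF C x] by (auto simp: F_def)
  have same: "F = face_at C (x t)" and sp: "- g (x (Suc t)) \<in> self_proj C F"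
    and B: "B (Suc t) = (if H t = None then \<Phi> F else B t)"
    and S: "S (Suc t) = (if H t = None then [] else S t) @
      [(reduce_vec (B (Suc t)) (x (Suc t) - x t), reduce_vec (B (Suc t)) (g (x (Suc t)) - g (x t)))]"
    and H: "Ht = lbfgs_mat (memory p) (mu p) (length (B (Suc t))) (S (Suc t))"
    using update[of t] Suc.prems by (auto simp: model_update_def Let_def F_def split: if_splits)
  have on: "orthonormal_columns (B (Suc t)) (diff_hull F)"
  proof (cases "H t")
    case None
    then show ?thesis
      using \<Phi>[OF F(1)] F(2) rel_interior_subset by (auto simp: B)
  next
    case (Some Ht')
    then show ?thesis
      using Suc.IH[OF Some] by (simp add: B same)
  qed
  have "x (Suc t) \<in> F" "x t \<in> F"
    using F(2) face_at_polyhedron(2)[OF C x, of t] rel_interior_subset by (auto simp: same)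
  then have "x (Suc t) - x t \<in> diff_hull F"
    unfolding diff_hull_def by (intro span_base) auto
  note new = curvature_pair_of_gradients[OF ssc on this]
  have "curvature_pair (B (Suc t)) m L pr" if "pr \<in> set (S (Suc t))" for pr
  proof (cases "H t")
    case None
    then show ?thesis
      using that new by (simp add: S)
  next
    case (Some Ht')
    then show ?thesis
      using that new Suc.IH[OF Some] by (auto simp: S B)
  qed
  with on sp H show ?case
    by (simp add: F_def)
qed

section \<open>Convergence\<close>

lemma hybrid_moves_contract:
  fixes C :: "(real ^ 'n) set"
  assumes ssc: "smooth_strongly_convex f g m L" and C: "polyhedron C" and p: "valid_params p"
    and \<Phi>: "\<And>F. F face_of C \<Longrightarrow> F \<noteq> {} \<Longrightarrow> orthonormal_columns (\<Phi> F) (diff_hull F)"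
    and init: "x 0 \<in> C" "H 0 = None" "r 0 = 0"
    and move: "\<And>t. hybrid_move p C f g x H B r t"
    and update: "\<And>t. model_update p C g \<Phi> x H B S t"
    and z: "z \<in> C" and min: "\<And>y. y \<in> C \<Longrightarrow> f z \<le> f y"
  shows "(\<forall>t. x t \<in> C) \<and> (\<lambda>t. f (x t) - f z) \<longlonglongrightarrow> 0"
proof -
  interpret smooth_strongly_convex f g m L by fact
  have cC: "closed C" "convex C"
    using C polyhedron_imp_closed polyhedron_imp_convex by auto
  have in_C: "x t \<in> C" for t
  proof (induction t)
    case 0
    show ?case by fact
  next
    case (Suc t)
    have "face_at C (x t) \<subseteq> C"
      using face_at_polyhedron(1)[OF C Suc] face_of_imp_subset by blast
    moreover have "pg_next p C f g x (r t) t \<in> C"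
      unfolding pg_next_def Let_def pg_point_def using cC z by (intro closest_point_in_set) auto
    ultimately show ?case
      using move[of t] unfolding hybrid_move_def qn_step_def by auto
  qed
  have r_le: "r t \<le> t" for t
  proof (induction t)
    case (Suc t)
    then show ?case
      using move[of t] unfolding hybrid_move_def by auto
  qed (simp add: init)
  have "0 < mu p"
    using p by (simp add: valid_params_def)
  from lbfgs_mat_uniform_bounds[OF m_pos m_le_L this] obtain a b where "0 < a" "0 < b"
    and ab: "\<And>(B :: (real ^ 'n) list) V ps. orthonormal_columns B V \<Longrightarrow>
       (\<And>pr. pr \<in> set ps \<Longrightarrow> curvature_pair B m L pr) \<Longrightarrow>
       model_bounds B a b (lbfgs_mat (memory p) (mu p) (length B) ps)"
    by metis
  obtain q1 where q1: "0 \<le> q1" "q1 < 1" "\<And>x r t. x t \<in> C \<Longrightarrow> f (x t) \<le> hist_max p f x r t \<Longrightarrow>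
       f (pg_next p C f g x r t) - f z \<le> q1 * (hist_max p f x r t - f z)"
    using pg_next_contraction[OF ssc p cC z min] by metis
  obtain q2 where q2: "0 \<le> q2" "q2 < 1"
    "\<And>x x' B H. x \<in> C \<Longrightarrow> - g x \<in> self_proj C (face_at C x) \<Longrightarrow>
       orthonormal_columns B (diff_hull (face_at C x)) \<Longrightarrow> model_bounds B a b H \<Longrightarrow>
       qn_step p C f g x (qn_direction B H (g x)) x' \<Longrightarrow> f x' - f z \<le> q2 * (f x - f z)"
    using qn_step_contraction[OF ssc p C z min \<open>0 < a\<close> \<open>0 < b\<close>] by metis
  define q where "q = max q1 q2"
  have "(\<lambda>t. f (x t) - f z) \<longlonglongrightarrow> 0"
  proof (rule windowed_contraction_tendsto_0[where q = q and M = "hist_len p"])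
    show gap_nonneg: "0 \<le> f (x t) - f z" for t
      using min[OF in_C] by simp
    show "0 \<le> q" "q < 1"
      using q1 q2 by (auto simp: q_def)
    fix t
    from move[of t] consider
      (qn) Ht where "H t = Some Ht" "qn_step p C f g (x t) (qn_direction (B t) Ht (g (x t))) (x (Suc t))"
      | (pg) "x (Suc t) = pg_next p C f g x (r t) t"
      unfolding hybrid_move_def by auto
    then show "\<exists>j\<le>t. t < j + hist_len p \<and> f (x (Suc t)) - f z \<le> q * (f (x j) - f z)"
    proof cases
      case qn
      note inv = model_update_invariant[OF ssc C \<Phi> in_C init(2) update qn(1)]
      have "model_bounds (B t) a b Ht"
        using inv ab by metis
      then have "f (x (Suc t)) - f z \<le> q2 * (f (x t) - f z)"
        using inv by (intro q2(3)[OF in_C _ _ _ qn(2)]) auto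
      also have "\<dots> \<le> q * (f (x t) - f z)"
        using gap_nonneg by (intro mult_right_mono) (auto simp: q_def)
      finally show ?thesis
        using p by (intro exI[of _ t]) (auto simp: valid_params_def)
    next
      case pg
      obtain j where j: "j \<le> t" "t < j + hist_len p" "hist_max p f x (r t) t = f (x j)"
        using hist_max_bounds(2)[OF p r_le] by blast
      have "f (x (Suc t)) - f z \<le> q1 * (f (x j) - f z)"
        using q1(3)[of x t "r t"] in_C hist_max_bounds(1)[OF p r_le[of t], of f x] by (simp add: pg j)
      also have "\<dots> \<le> q * (f (x j) - f z)"
        using gap_nonneg by (intro mult_right_mono) (auto simp: q_def)
      finally show ?thesis
        using j by blast
    qed
  qed
  with in_C show ?thesis
    by blast
qed

theorem theorem3p2:
  fixes C :: "(real ^ 'n) set"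
    and f :: "real ^ 'n \<Rightarrow> real"
    and g :: "real ^ 'n \<Rightarrow> real ^ 'n"
    and Hess :: "real ^ 'n \<Rightarrow> real ^ 'n ^ 'n"
    and \<mu>\<^sub>1 \<mu>\<^sub>2 :: real
    and p :: hybrid_params
    and \<Phi> :: "(real ^ 'n) set \<Rightarrow> (real ^ 'n) list"
    and x0 :: "real ^ 'n"
    and x :: "nat \<Rightarrow> real ^ 'n"
  assumes "polyhedron C"
    and "convex_on UNIV f"
    and "\<And>u. GDERIV f u :> g u"
    and "\<And>u. (g has_derivative (\<lambda>v. Hess u *v v)) (at u)"
    and "continuous_on UNIV Hess"
    and "bdd_below (range f)"
    and "0 < \<mu>\<^sub>1" and "\<mu>\<^sub>1 \<le> \<mu>\<^sub>2"
    and "\<And>u v. \<mu>\<^sub>1 * (norm v)\<^sup>2 \<le> v \<bullet> (Hess u *v v)"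
    and "\<And>u v. v \<bullet> (Hess u *v v) \<le> \<mu>\<^sub>2 * (norm v)\<^sup>2"
    and "valid_params p"
    and "\<And>F. F face_of C \<Longrightarrow> F \<noteq> {} \<Longrightarrow> orthonormal_columns (\<Phi> F) (diff_hull F)"
    and "x0 \<in> C"
    and "hybrid_run p C f g \<Phi> x0 x"
  shows "\<exists>z. is_arg_min f (\<lambda>y. y \<in> C) z \<and> (\<forall>w. is_arg_min f (\<lambda>y. y \<in> C) w \<longrightarrow> w = z) \<and>
             x \<longlonglongrightarrow> z"
proof -
  have ssc: "smooth_strongly_convex f g \<mu>\<^sub>1 \<mu>\<^sub>2"
    using assms(3,4,7,8,9,10) by (rule smooth_strongly_convex_of_hessian)
  interpret smooth_strongly_convex f g \<mu>\<^sub>1 \<mu>\<^sub>2 by fact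
  have C: "closed C" "convex C"
    using assms(1) polyhedron_imp_closed polyhedron_imp_convex by auto
  have "continuous_on UNIV f"
    using assms(3) has_derivative_continuous unfolding gderiv_def
    by (intro continuous_at_imp_continuous_on ballI) blast
  then obtain z where z: "z \<in> C" and min: "\<And>y. y \<in> C \<Longrightarrow> f z \<le> f y"
    using minimizer_exists[OF C(1) assms(13)] by metis
  have unique: "w = z" if "w \<in> C" "f w \<le> f z" for w
  proof -
    have "\<mu>\<^sub>1 / 4 * (norm (w - z))\<^sup>2 \<le> 0"
      using quadratic_growth[OF C(2) that(1) z min] that(2) by linarith
    then show ?thesis
      using m_pos by (simp add: mult_le_0_iff)
  qed
  have "x \<longlonglongrightarrow> z"
  proof -
    obtain H B S r where init: "x 0 = x0" "H 0 = None" "r 0 = 0"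
      and run: "\<And>t. (closest_point C (x t - g (x t)) = x t \<and> (\<forall>s \<ge> t. x s = x t)) \<or>
             (hybrid_move p C f g x H B r t \<and> model_update p C g \<Phi> x H B S t)"
      using assms(14) unfolding hybrid_run_def by blast
    show ?thesis
    proof (cases "\<exists>t. closest_point C (x t - g (x t)) = x t \<and> (\<forall>s \<ge> t. x s = x t)")
      case True
      then obtain t where stat: "closest_point C (x t - g (x t)) = x t" and const: "\<And>s. t \<le> s \<Longrightarrow> x s = x t"
        by blast
      have "x t \<in> C"
        using closest_point_in_set[OF C(1), of "x t - g (x t)"] z by (auto simp: stat)
      moreover have "0 \<le> g (x t) \<bullet> (z - x t)"
        using closest_point_dot[OF C(2,1) z, of "x t - g (x t)"] by (simp add: stat)
      then have "f (x t) \<le> f z"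
        using gradient_inequality[of "x t" z] by linarith
      ultimately have "x t = z"
        by (rule unique)
      then have "eventually (\<lambda>s. x s = z) sequentially"
        using const unfolding eventually_sequentially by blast
      then show ?thesis
        by (rule tendsto_eventually)
    next
      case False
      then have move: "hybrid_move p C f g x H B r t" and update: "model_update p C g \<Phi> x H B S t" for t
        using run[of t] by auto
      have "x 0 \<in> C"
        using init(1) assms(13) by simp
      have in_C: "\<And>t. x t \<in> C" and lim: "(\<lambda>t. f (x t) - f z) \<longlonglongrightarrow> 0"
        using hybrid_moves_contract[where x = x and H = H and r = r and B = B and S = S and z = z,
            OF ssc assms(1,11,12) \<open>x 0 \<in> C\<close> init(2,3) move update z min]
        by simp_all
      have le: "(norm (x t - z))\<^sup>2 \<le> 4 / \<mu>\<^sub>1 * (f (x t) - f z)" for t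
        using quadratic_growth[OF C(2) in_C z min, of t] m_pos by (simp add: field_simps)
      have "(\<lambda>t. 4 / \<mu>\<^sub>1 * (f (x t) - f z)) \<longlonglongrightarrow> 0"
        using lim by (rule tendsto_mult_right_zero)
      then have "(\<lambda>t. (norm (x t - z))\<^sup>2) \<longlonglongrightarrow> 0"
        by (rule tendsto_sandwich[OF always_eventually always_eventually tendsto_const, rotated 2])
          (use le in auto)
      then have "(\<lambda>t. sqrt ((norm (x t - z))\<^sup>2)) \<longlonglongrightarrow> sqrt 0"
        by (rule tendsto_real_sqrt)
      then have "(\<lambda>t. norm (x t - z)) \<longlonglongrightarrow> 0"
        by simp
      then show ?thesis
        by (simp add: tendsto_norm_zero_iff LIM_zero_iff)
    qed
  qed
  moreover have "is_arg_min f (\<lambda>y. y \<in> C) w \<longleftrightarrow> w = z" for w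
    using z min unique by (auto simp: is_arg_min_def not_less intro: order_antisym)
  ultimately show ?thesis
    by blast
qed

end
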